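(* Let $a<b$, $n,m\in\mathbb N$, $\Omega=\prod_{i=1}^n[a_i,b_i]$, $P=[a,b]\times\Omega$, $\alpha=(\alpha_1,\ldots,\alpha_m)$ and $\beta_i=(\beta_{i,1},\ldots,\beta_{i,m})$ ($i=1,\ldots,n$) with all $\alpha_j,\beta_{i,j}\in(0,1)$, $z_a\in\mathbb R$, and $g:\partial P\to\mathbb R^m$ given. Call $u=(u_1,\ldots,u_m)$ admissible if $u_j\in C^1(P,\mathbb R)$, ${^C_aD^{\alpha_j}_t}u_j,{^C_{a_i}D^{\beta_{i,j}}_{x_i}}u_j\in C^1(P,\mathbb R)$ for all $i,j$, and $u=g$ on $\partial P$. Let $L:P\times\mathbb R^{m(n+2)+1}\to\mathbb R$ be of class $C^1$, and for admissible $u$ let $z[u;\cdot]$ be the solution of $$\frac{dz}{dt}=\int_\Omega L\big(t,x,u(t,x),{^C_aD^{\alpha}_t}u(t,x),{^C_{a_1}D^{\beta_1}_{x_1}}u(t,x),\ldots,{^C_{a_n}D^{\beta_n}_{x_n}}u(t,x),z(t)\big)\,d^nx,\quad t\in[a,b],\qquad z(a)=z_a.$$ Write $[u,z](t,x)$ for the argument tuple of $L$ above and $\lambda(t):=\exp\left(-\int_a^t\int_\Omega\frac{\partial L}{\partial z}[u,z](\tau,x)\,d^nx\,d\tau\right)$, and assume that for all $i\in\{1,\ldots,n\}$, $j\in\{1,\ldots,m\}$ the functions ${_tD^{\alpha_j}_b}\left(\lambda(t)\frac{\partial L}{\partial {^C_aD^{\alpha_j}_t}u_j}[u,z](t,x)\right)$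 and ${_{x_i}D^{\beta_{i,j}}_{b_i}}\left(\lambda(t)\frac{\partial L}{\partial {^C_{a_i}D^{\beta_{i,j}}_{x_i}}u_j}[u,z](t,x)\right)$ exist and are continuous on $P$. If $u$ is admissible and $z[u;b]$ attains an extremum (so $\frac{d}{d\epsilon}z[u+\epsilon\eta;b]|_{\epsilon=0}=0$ for all $\eta\in C^1(P,\mathbb R^m)$ with $\eta=0$ on $\partial P$ and ${^C_aD^{\alpha_j}_t}\eta_j,{^C_{a_i}D^{\beta_{i,j}}_{x_i}}\eta_j\in C^1(P,\mathbb R)$), then for $j=1,\ldots,m$, on $P$, $$\lambda(t)\frac{\partial L}{\partial u_j}[u,z](t,x)+{_tD^{\alpha_j}_b}\left(\lambda(t)\frac{\partial L}{\partial {^C_aD^{\alpha_j}_t}u_j}[u,z](t,x)\right)+\sum_{i=1}^n{_{x_i}D^{\beta_{i,j}}_{b_i}}\left(\lambda(t)\frac{\partial L}{\partial {^C_{a_i}D^{\beta_{i,j}}_{x_i}}u_j}[u,z](t,x)\right)=0.$$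
   Context: Notation: $x=(x_1,\ldots,x_n)\in\Omega$, $d^nx=dx_1\cdots dx_n$, ${^C_aD^\alpha_t}u=({^C_aD^{\alpha_1}_t}u_1,\ldots,{^C_aD^{\alpha_m}_t}u_m)$, ${^C_{a_i}D^{\beta_i}_{x_i}}u=({^C_{a_i}D^{\beta_{i,1}}_{x_i}}u_1,\ldots,{^C_{a_i}D^{\beta_{i,m}}_{x_i}}u_m)$. For order $\gamma\in(0,1)$, the partial left Caputo derivative in the variable $s\in[c,d]$ (with the other variables frozen) is ${^C_cD^\gamma_s}f=\frac{1}{\Gamma(1-\gamma)}\int_c^s(s-\sigma)^{-\gamma}\partial_\sigma f(\ldots,\sigma,\ldots)\,d\sigma$, and the partial right Riemann–Liouville derivative is ${_sD^\gamma_d}f=\frac{-1}{\Gamma(1-\gamma)}\frac{\partial}{\partial s}\int_s^d(\sigma-s)^{-\gamma}f(\ldots,\sigma,\ldots)\,d\sigma$. Partial derivatives of $L$ are with respect to the indicated components of its arguments. The solution $z$ is assumed to exist and depend differentiably on $\epsilon$ when $u$ is replaced by $u+\epsilon\eta$, with the same initial value $z_a$. *)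

theory Defs
  imports "HOL-Analysis.Analysis"
begin

definition C1_on :: "'a::real_normed_vector set \<Rightarrow> ('a \<Rightarrow> 'b::real_normed_vector) \<Rightarrow> bool" where
  "C1_on S f \<longleftrightarrow> (\<exists>f'. (\<forall>p\<in>S. (f has_derivative blinfun_apply (f' p)) (at p within S))
                        \<and> continuous_on S f')"

definition caputo_left :: "real \<Rightarrow> real \<Rightarrow> real \<Rightarrow> (real \<Rightarrow> real) \<Rightarrow> real \<Rightarrow> real" where
  "caputo_left c d \<gamma> f s = 1 / Gamma (1 - \<gamma>) *
     integral {c..s} (\<lambda>\<sigma>. (s - \<sigma>) powr (- \<gamma>) * vector_derivative f (at \<sigma> within {c..d}))"

definition RL_right_int :: "real \<Rightarrow> real \<Rightarrow> (real \<Rightarrow> real) \<Rightarrow> real \<Rightarrow> real" where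
  "RL_right_int d \<gamma> f s = integral {s..d} (\<lambda>\<sigma>. (\<sigma> - s) powr (- \<gamma>) * f \<sigma>)"

definition RL_right :: "real \<Rightarrow> real \<Rightarrow> real \<Rightarrow> (real \<Rightarrow> real) \<Rightarrow> real \<Rightarrow> real" where
  "RL_right c d \<gamma> f s = - 1 / Gamma (1 - \<gamma>) *
     vector_derivative (RL_right_int d \<gamma> f) (at s within {c..d})"

definition RL_right_exists :: "real \<Rightarrow> real \<Rightarrow> real \<Rightarrow> (real \<Rightarrow> real) \<Rightarrow> real \<Rightarrow> bool" where
  "RL_right_exists c d \<gamma> f s \<longleftrightarrow> RL_right_int d \<gamma> f differentiable (at s within {c..d})"

definition Pset :: "real \<Rightarrow> real \<Rightarrow> real^'n \<Rightarrow> real^'n \<Rightarrow> (real \<times> (real^'n)) set" where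
  "Pset a b aa bb = {a..b} \<times> cbox aa bb"

definition xupd :: "real^'n \<Rightarrow> 'n \<Rightarrow> real \<Rightarrow> real^'n" where
  "xupd x i s = (\<chi> k. if k = i then s else x $ k)"

definition caputo_t :: "real \<Rightarrow> real \<Rightarrow> real \<Rightarrow> (real \<times> (real^'n) \<Rightarrow> real) \<Rightarrow> real \<times> (real^'n) \<Rightarrow> real" where
  "caputo_t a b \<gamma> f p = caputo_left a b \<gamma> (\<lambda>s. f (s, snd p)) (fst p)"

definition caputo_x :: "real^'n \<Rightarrow> real^'n \<Rightarrow> 'n \<Rightarrow> real \<Rightarrow> (real \<times> (real^'n) \<Rightarrow> real) \<Rightarrow> real \<times> (real^'n) \<Rightarrow> real" where
  "caputo_x aa bb i \<gamma> f p = caputo_left (aa $ i) (bb $ i) \<gamma> (\<lambda>s. f (fst p, xupd (snd p) i s)) (snd p $ i)"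

definition RL_t :: "real \<Rightarrow> real \<Rightarrow> real \<Rightarrow> (real \<times> (real^'n) \<Rightarrow> real) \<Rightarrow> real \<times> (real^'n) \<Rightarrow> real" where
  "RL_t a b \<gamma> f p = RL_right a b \<gamma> (\<lambda>s. f (s, snd p)) (fst p)"

definition RL_t_exists :: "real \<Rightarrow> real \<Rightarrow> real \<Rightarrow> (real \<times> (real^'n) \<Rightarrow> real) \<Rightarrow> real \<times> (real^'n) \<Rightarrow> bool" where
  "RL_t_exists a b \<gamma> f p \<longleftrightarrow> RL_right_exists a b \<gamma> (\<lambda>s. f (s, snd p)) (fst p)"

definition RL_x :: "real^'n \<Rightarrow> real^'n \<Rightarrow> 'n \<Rightarrow> real \<Rightarrow> (real \<times> (real^'n) \<Rightarrow> real) \<Rightarrow> real \<times> (real^'n) \<Rightarrow> real" where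
  "RL_x aa bb i \<gamma> f p = RL_right (aa $ i) (bb $ i) \<gamma> (\<lambda>s. f (fst p, xupd (snd p) i s)) (snd p $ i)"

definition RL_x_exists :: "real^'n \<Rightarrow> real^'n \<Rightarrow> 'n \<Rightarrow> real \<Rightarrow> (real \<times> (real^'n) \<Rightarrow> real) \<Rightarrow> real \<times> (real^'n) \<Rightarrow> bool" where
  "RL_x_exists aa bb i \<gamma> f p \<longleftrightarrow> RL_right_exists (aa $ i) (bb $ i) \<gamma> (\<lambda>s. f (fst p, xupd (snd p) i s)) (snd p $ i)"

definition admissible :: "real \<Rightarrow> real \<Rightarrow> real^'n \<Rightarrow> real^'n \<Rightarrow> real^'m \<Rightarrow> real^'m^'n
     \<Rightarrow> (real \<times> (real^'n) \<Rightarrow> real^'m) \<Rightarrow> (real \<times> (real^'n) \<Rightarrow> real^'m) \<Rightarrow> bool" where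
  "admissible a b aa bb \<alpha> \<beta> g u \<longleftrightarrow>
     (\<forall>j. C1_on (Pset a b aa bb) (\<lambda>p. u p $ j)
        \<and> C1_on (Pset a b aa bb) (caputo_t a b (\<alpha> $ j) (\<lambda>p. u p $ j))
        \<and> (\<forall>i. C1_on (Pset a b aa bb) (caputo_x aa bb i (\<beta> $ i $ j) (\<lambda>p. u p $ j))))
     \<and> (\<forall>p\<in>frontier (Pset a b aa bb). u p = g p)"

type_synonym ('n,'m) larg = "(real \<times> (real^'n)) \<times> (real^'m) \<times> (real^'m) \<times> (real^'m^'n) \<times> real"

definition largs :: "real \<Rightarrow> real \<Rightarrow> real^'n \<Rightarrow> real^'n \<Rightarrow> real^'m \<Rightarrow> real^'m^'n
     \<Rightarrow> (real \<times> (real^'n) \<Rightarrow> real^'m) \<Rightarrow> real \<Rightarrow> real \<Rightarrow> real^'n \<Rightarrow> ('n,'m) larg" where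
  "largs a b aa bb \<alpha> \<beta> u zt t x =
     ((t, x), u (t, x),
      (\<chi> j. caputo_t a b (\<alpha> $ j) (\<lambda>p. u p $ j) (t, x)),
      (\<chi> i. \<chi> j. caputo_x aa bb i (\<beta> $ i $ j) (\<lambda>p. u p $ j) (t, x)),
      zt)"

definition pderivL :: "(('n::finite,'m::finite) larg \<Rightarrow> real) \<Rightarrow> ('n,'m) larg \<Rightarrow> ('n,'m) larg \<Rightarrow> real" where
  "pderivL L q v = deriv (\<lambda>s. L (q + s *\<^sub>R v)) 0"

definition dir_u :: "'m::finite \<Rightarrow> ('n::finite,'m) larg" where
  "dir_u j = (0, axis j 1, 0, 0, 0)"

definition dir_Dt :: "'m::finite \<Rightarrow> ('n::finite,'m) larg" where
  "dir_Dt j = (0, 0, axis j 1, 0, 0)"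

definition dir_Dx :: "'n::finite \<Rightarrow> 'm::finite \<Rightarrow> ('n,'m) larg" where
  "dir_Dx i j = (0, 0, 0, axis i (axis j 1), 0)"

definition dir_z :: "('n::finite,'m::finite) larg" where
  "dir_z = (0, 0, 0, 0, 1)"

definition lam :: "(('n::finite,'m::finite) larg \<Rightarrow> real) \<Rightarrow> real \<Rightarrow> real \<Rightarrow> real^'n \<Rightarrow> real^'n \<Rightarrow> real^'m \<Rightarrow> real^'m^'n
     \<Rightarrow> (real \<times> (real^'n) \<Rightarrow> real^'m) \<Rightarrow> (real \<Rightarrow> real) \<Rightarrow> real \<Rightarrow> real" where
  "lam L a b aa bb \<alpha> \<beta> u z t = exp (- integral {a..t}
      (\<lambda>\<tau>. integral (cbox aa bb) (\<lambda>x. pderivL L (largs a b aa bb \<alpha> \<beta> u (z \<tau>) \<tau> x) dir_z)))"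

definition lamLv :: "(('n::finite,'m::finite) larg \<Rightarrow> real) \<Rightarrow> real \<Rightarrow> real \<Rightarrow> real^'n \<Rightarrow> real^'n \<Rightarrow> real^'m \<Rightarrow> real^'m^'n
     \<Rightarrow> (real \<times> (real^'n) \<Rightarrow> real^'m) \<Rightarrow> (real \<Rightarrow> real) \<Rightarrow> ('n,'m) larg \<Rightarrow> real \<times> (real^'n) \<Rightarrow> real" where
  "lamLv L a b aa bb \<alpha> \<beta> u z v p =
     lam L a b aa bb \<alpha> \<beta> u z (fst p) * pderivL L (largs a b aa bb \<alpha> \<beta> u (z (fst p)) (fst p) (snd p)) v"

end

theory Submission
  imports Defs
begin

text \<open>
  Let \<open>\<zeta>(t)\<close> be the derivative of \<open>z[u + \<epsilon>\<eta>; t]\<close> at \<open>\<epsilon> = 0\<close>. Differentiating the integrated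
  equation for \<open>z\<close> under the integral sign gives a linear equation for \<open>\<zeta>\<close> with \<open>\<zeta>(a) = 0\<close>, whose
  integrating factor is \<open>\<lambda>\<close>; since \<open>\<zeta>(b) = 0\<close>, the integral over \<open>P\<close> of \<open>\<lambda>\<close> times the
  derivative of \<open>L\<close> in the direction of \<open>\<eta>\<close> and its Caputo derivatives vanishes. Fractional
  integration by parts in each variable (Fubini for the kernel \<open>(s - \<sigma>) powr (- \<gamma>)\<close>, then ordinary
  integration by parts) moves the Caputo derivatives off \<open>\<eta>\<close>. Products of one-variable bumps
  \<open>max 0 ((s - p) * (q - s)) ^ 4\<close> are admissible variations, so the Euler-Lagrange expression,
  which is continuous, is zero.
\<close>

section \<open>Continuously differentiable functions\<close>

text \<open>The left Caputo derivative is not local: to the right of the support of a test function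
  it is in general nonzero, and admissibility asks it to be C^1 up to the boundary of the box.
  Smoothness of a variation is therefore not enough. The singular kernel is first traded for a
  continuous one, by an integration by parts that leaves no boundary term because the bump is flat
  at the left end. The product form reduces this to one variable, since a partial Caputo derivative
  treats the other factors as constants. The equation for z is differentiated in its integrated form
  because z is known to be only once continuously differentiable in (\<epsilon>, t) jointly: no
  mixed second derivative is at hand, and the time derivative of \<zeta> is read off from an
  integral representation. The kernel is unbounded at the diagonal, so exchanging integrals there
  needs Lebesgue integrability rather than continuity. Bumps inside the box give the equation at
  interior points only; its continuity carries it to the boundary.\<close>

lemma C1_on_imp_continuous_on: "C1_on S f \<Longrightarrow> continuous_on S f"
  unfolding C1_on_def by (meson has_derivative_continuous continuous_on_eq_continuous_within)

lemma C1_on_cong: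
  assumes "C1_on S f" "\<And>p. p \<in> S \<Longrightarrow> f p = g p"
  shows "C1_on S g"
  using assms unfolding C1_on_def by (metis has_derivative_transform)

lemma C1_on_const: "C1_on S (\<lambda>_. c)"
  unfolding C1_on_def
  by (rule exI[of _ "\<lambda>_. 0"]) (auto simp: zero_blinfun.rep_eq intro!: derivative_eq_intros)

lemma C1_on_add:
  assumes "C1_on S f" "C1_on S g"
  shows "C1_on S (\<lambda>p. f p + g p)"
proof -
  obtain f' g' where
    "\<forall>p\<in>S. (f has_derivative blinfun_apply (f' p)) (at p within S)" "continuous_on S f'"
    "\<forall>p\<in>S. (g has_derivative blinfun_apply (g' p)) (at p within S)" "continuous_on S g'"
    using assms unfolding C1_on_def by blast
  then show ?thesis unfolding C1_on_def
    by (intro exI[of _ "\<lambda>p. f' p + g' p"])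
       (auto simp: plus_blinfun.rep_eq intro!: has_derivative_add continuous_intros)
qed

lemma C1_on_mult:
  fixes f g :: "'a::real_normed_vector \<Rightarrow> real"
  assumes "C1_on S f" "C1_on S g"
  shows "C1_on S (\<lambda>p. f p * g p)"
proof -
  obtain f' g' where
    *: "\<forall>p\<in>S. (f has_derivative blinfun_apply (f' p)) (at p within S)" "continuous_on S f'"
    "\<forall>p\<in>S. (g has_derivative blinfun_apply (g' p)) (at p within S)" "continuous_on S g'"
    using assms unfolding C1_on_def by blast
  have "((\<lambda>p. f p * g p) has_derivative blinfun_apply (f p *\<^sub>R g' p + g p *\<^sub>R f' p)) (at p within S)"
    if "p \<in> S" for p
    using has_derivative_mult[OF *(1)[rule_format, OF that] *(3)[rule_format, OF that]]
    by (simp add: plus_blinfun.rep_eq scaleR_blinfun.rep_eq mult.commute)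
  with * assms[THEN C1_on_imp_continuous_on] show ?thesis unfolding C1_on_def
    by (intro exI[of _ "\<lambda>p. f p *\<^sub>R g' p + g p *\<^sub>R f' p"]) (auto intro!: continuous_intros)
qed

lemma C1_on_prod:
  fixes f :: "'i \<Rightarrow> 'a::real_normed_vector \<Rightarrow> real"
  assumes "\<And>i. i \<in> I \<Longrightarrow> C1_on S (f i)"
  shows "C1_on S (\<lambda>p. \<Prod>i\<in>I. f i p)"
  using assms by (induction I rule: infinite_finite_induct) (auto intro: C1_on_const C1_on_mult)

text \<open>Coordinate projections are bounded linear, so this covers functions of a single
  coordinate; products of them give every C^1 claim about the test variations.\<close>

lemma C1_on_compose_bounded_linear:
  fixes h :: "real \<Rightarrow> real"
  assumes h: "\<And>s. (h has_real_derivative h' s) (at s)" and h': "continuous_on UNIV h'"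
    and l: "bounded_linear l"
  shows "C1_on S (\<lambda>p. h (l p))"
  unfolding C1_on_def
proof (intro exI[of _ "\<lambda>p. h' (l p) *\<^sub>R Blinfun l"] conjI ballI)
  fix p
  have "((\<lambda>p. h (l p)) has_derivative (\<lambda>x. l x * h' (l p))) (at p within S)"
    by (rule has_derivative_compose[OF bounded_linear_imp_has_derivative[OF l], of h])
       (use h[of "l p"] in \<open>simp add: has_field_derivative_def mult_commute_abs\<close>)
  then show "((\<lambda>p. h (l p)) has_derivative blinfun_apply (h' (l p) *\<^sub>R Blinfun l)) (at p within S)"
    using l by (simp add: scaleR_blinfun.rep_eq bounded_linear_Blinfun_apply mult.commute)
next
  have "continuous_on S l" using l by (rule linear_continuous_on)
  then have "continuous_on S (\<lambda>p. h' (l p))"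
    using continuous_on_compose2[OF h'] by blast
  then show "continuous_on S (\<lambda>p. h' (l p) *\<^sub>R Blinfun l)"
    by (intro continuous_intros)
qed

section \<open>Fractional integration by parts\<close>

text \<open>The primitive is continuous up to the singular endpoint but need not be differentiable
  there, hence the interior form of the fundamental theorem. The condition
  \<open>\<gamma> < 1\<close> makes the exponent \<open>1 - \<gamma>\<close> positive, so the
  primitive vanishes at that endpoint.\<close>

lemma has_integral_powr_kernel_left:
  fixes c s \<gamma> :: real
  assumes "\<gamma> < 1" "c \<le> s"
  shows "((\<lambda>\<sigma>. (s - \<sigma>) powr (- \<gamma>)) has_integral (s - c) powr (1 - \<gamma>) / (1 - \<gamma>)) {c..s}"
proof -
  have "((\<lambda>\<sigma>. (s - \<sigma>) powr (- \<gamma>)) has_integral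
      (- ((s - s) powr (1 - \<gamma>) / (1 - \<gamma>)) - - ((s - c) powr (1 - \<gamma>) / (1 - \<gamma>)))) {c..s}"
  proof (rule fundamental_theorem_of_calculus_interior)
    show "continuous_on {c..s} (\<lambda>\<sigma>. - ((s - \<sigma>) powr (1 - \<gamma>) / (1 - \<gamma>)))"
      using assms by (intro continuous_intros continuous_on_powr') auto
    show "((\<lambda>\<sigma>. - ((s - \<sigma>) powr (1 - \<gamma>) / (1 - \<gamma>))) has_vector_derivative (s - x) powr (- \<gamma>)) (at x)"
      if "x \<in> {c<..<s}" for x
      unfolding has_real_derivative_iff_has_vector_derivative[symmetric]
      using that assms by (auto intro!: derivative_eq_intros DERIV_fun_powr[THEN DERIV_cong])
  qed (use assms in auto)
  then show ?thesis by simp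
qed

lemma has_integral_powr_kernel_right:
  fixes d \<sigma> \<gamma> :: real
  assumes "\<gamma> < 1" "\<sigma> \<le> d"
  shows "((\<lambda>s. (s - \<sigma>) powr (- \<gamma>)) has_integral (d - \<sigma>) powr (1 - \<gamma>) / (1 - \<gamma>)) {\<sigma>..d}"
proof -
  have "((\<lambda>s. (s - \<sigma>) powr (- \<gamma>)) has_integral
      ((d - \<sigma>) powr (1 - \<gamma>) / (1 - \<gamma>) - (\<sigma> - \<sigma>) powr (1 - \<gamma>) / (1 - \<gamma>))) {\<sigma>..d}"
  proof (rule fundamental_theorem_of_calculus_interior)
    show "continuous_on {\<sigma>..d} (\<lambda>s. (s - \<sigma>) powr (1 - \<gamma>) / (1 - \<gamma>))"
      using assms by (intro continuous_intros continuous_on_powr') auto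
    show "((\<lambda>s. (s - \<sigma>) powr (1 - \<gamma>) / (1 - \<gamma>)) has_vector_derivative (x - \<sigma>) powr (- \<gamma>)) (at x)"
      if "x \<in> {\<sigma><..<d}" for x
      unfolding has_real_derivative_iff_has_vector_derivative[symmetric]
      using that assms by (auto intro!: derivative_eq_intros DERIV_fun_powr[THEN DERIV_cong])
  qed (use assms in auto)
  then show ?thesis by simp
qed

text \<open>A nonnegative integrable kernel is absolutely integrable, and this survives
  multiplication by a bounded measurable factor; the singularity excludes an argument by
  continuity.\<close>

lemma powr_kernel_left_integrable:
  fixes h :: "real \<Rightarrow> real"
  assumes "\<gamma> < 1" "continuous_on {c..s} h"
  shows "(\<lambda>\<sigma>. (s - \<sigma>) powr (- \<gamma>) * h \<sigma>) integrable_on {c..s}"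
proof (cases "c \<le> s")
  case True
  have "(\<lambda>\<sigma>. (s - \<sigma>) powr (- \<gamma>)) absolutely_integrable_on {c..s}"
    using has_integral_powr_kernel_left[OF assms(1) True]
    by (intro nonnegative_absolutely_integrable_1) auto
  then have "(\<lambda>\<sigma>. h \<sigma> * (s - \<sigma>) powr (- \<gamma>)) absolutely_integrable_on {c..s}"
    using assms(2)
    by (intro absolutely_integrable_bounded_measurable_product_real)
       (auto intro: continuous_imp_measurable_on_sets_lebesgue compact_imp_bounded compact_continuous_image)
  then show ?thesis
    by (simp add: mult.commute set_lebesgue_integral_eq_integral(1))
qed auto

text \<open>Bridge from the explicit gauge integrals of the kernel to the Lebesgue integral, in
  which the theorems of Tonelli and Fubini are stated.\<close>

lemma has_bochner_integral_lborel_nonneg: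
  fixes f :: "'a::euclidean_space \<Rightarrow> real"
  assumes "f \<in> borel_measurable borel" "\<And>x. 0 \<le> f x" "(f has_integral I) UNIV"
  shows "has_bochner_integral lborel f I"
proof (rule has_bochner_integral_nn_integral)
  show "0 \<le> I" using has_integral_nonneg[OF assms(3)] assms(2) by simp
  show "(\<integral>\<^sup>+ x. ennreal (f x) \<partial>lborel) = ennreal I"
    using assms by (rule nn_integral_has_integral_lborel)
qed (use assms in auto)

text \<open>Fubini on the triangle \<open>c \<le> \<sigma> \<le> s \<le> d\<close>, with a kernel
  that is singular along the side \<open>\<sigma> = s\<close>.\<close>

lemma powr_kernel_swap:
  fixes f h :: "real \<Rightarrow> real"
  assumes \<gamma>: "\<gamma> < 1" and f: "continuous_on {c..d} f" and h: "continuous_on {c..d} h"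
  shows "integral {c..d} (\<lambda>s. f s * integral {c..s} (\<lambda>\<sigma>. (s - \<sigma>) powr (- \<gamma>) * h \<sigma>)) =
         integral {c..d} (\<lambda>\<sigma>. h \<sigma> * integral {\<sigma>..d} (\<lambda>s. (s - \<sigma>) powr (- \<gamma>) * f s))"
proof -
  \<comment> \<open>Cutting off by zero turns the variable limits into integrals over the whole
    line. \<open>F\<close> and \<open>G\<close> become Borel functions, and \<open>K\<close> is the
    kernel restricted to the triangle.\<close>
  define F where "F = (\<lambda>s. indicator {c..d} s *\<^sub>R f s)"
  define G where "G = (\<lambda>s. indicator {c..d} s *\<^sub>R h s)"
  define K where "K = (\<lambda>\<sigma> s. if c \<le> \<sigma> \<and> \<sigma> \<le> s \<and> s \<le> d then (s - \<sigma>) powr (- \<gamma>) else 0)"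
  define k where "k = (\<lambda>\<sigma> s. K \<sigma> s * (G \<sigma> * F s))"
  have [measurable]: "F \<in> borel_measurable borel" "G \<in> borel_measurable borel"
    unfolding F_def G_def using f h by (intro borel_measurable_continuous_on_indicator; simp)+
  have K[measurable]: "case_prod K \<in> borel_measurable (borel \<Otimes>\<^sub>M borel)"
    unfolding K_def by measurable
  have k[measurable]: "case_prod k \<in> borel_measurable (borel \<Otimes>\<^sub>M borel)"
    unfolding k_def by measurable
  have K1: "has_bochner_integral lborel (K \<sigma>)
      (if c \<le> \<sigma> \<and> \<sigma> \<le> d then (d - \<sigma>) powr (1 - \<gamma>) / (1 - \<gamma>) else 0)" for \<sigma>
  proof (rule has_bochner_integral_lborel_nonneg)
    show "(K \<sigma> has_integral (if c \<le> \<sigma> \<and> \<sigma> \<le> d then (d - \<sigma>) powr (1 - \<gamma>) / (1 - \<gamma>) else 0)) UNIV"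
    proof (cases "c \<le> \<sigma> \<and> \<sigma> \<le> d")
      case True
      then have "K \<sigma> = (\<lambda>s. if s \<in> {\<sigma>..d} then (s - \<sigma>) powr (- \<gamma>) else 0)"
        by (auto simp: K_def)
      with True has_integral_powr_kernel_right[OF \<gamma>, of \<sigma> d] show ?thesis
        by (simp only: has_integral_restrict_UNIV if_True simp_thms)
    next
      case False
      then have "K \<sigma> = (\<lambda>_. 0)" by (auto simp: K_def)
      with False show ?thesis by auto
    qed
  qed (auto simp: K_def)
  have K2: "has_bochner_integral lborel (\<lambda>\<sigma>. K \<sigma> s)
      (if c \<le> s \<and> s \<le> d then (s - c) powr (1 - \<gamma>) / (1 - \<gamma>) else 0)" for s
  proof (rule has_bochner_integral_lborel_nonneg)
    show "((\<lambda>\<sigma>. K \<sigma> s) has_integral (if c \<le> s \<and> s \<le> d then (s - c) powr (1 - \<gamma>) / (1 - \<gamma>) else 0)) UNIV"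
    proof (cases "c \<le> s \<and> s \<le> d")
      case True
      then have "(\<lambda>\<sigma>. K \<sigma> s) = (\<lambda>\<sigma>. if \<sigma> \<in> {c..s} then (s - \<sigma>) powr (- \<gamma>) else 0)"
        by (auto simp: K_def)
      with True has_integral_powr_kernel_left[OF \<gamma>, of c s] show ?thesis
        by (simp only: has_integral_restrict_UNIV if_True simp_thms)
    next
      case False
      then have "(\<lambda>\<sigma>. K \<sigma> s) = (\<lambda>_. 0)" by (auto simp: K_def)
      with False show ?thesis by auto
    qed
  qed (auto simp: K_def)
  \<comment> \<open>Integrating the nonnegative kernel over \<open>s\<close> first leaves a
    continuous function of \<sigma> on \<open>{c..d}\<close>, which settles integrability on the
    product.\<close>
  have intK: "integrable (lborel \<Otimes>\<^sub>M lborel) (case_prod K)"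
  proof (rule lborel_pair.Fubini_integrable)
    have eq: "(\<lambda>\<sigma>. \<integral>s. norm (case_prod K (\<sigma>, s)) \<partial>lborel) =
        (\<lambda>\<sigma>. indicator {c..d} \<sigma> *\<^sub>R ((d - \<sigma>) powr (1 - \<gamma>) / (1 - \<gamma>)))"
    proof
      fix \<sigma>
      have "norm (case_prod K (\<sigma>, s)) = K \<sigma> s" for s by (simp add: K_def)
      with has_bochner_integral_integral_eq[OF K1[of \<sigma>]]
      show "(\<integral>s. norm (case_prod K (\<sigma>, s)) \<partial>lborel) =
          indicator {c..d} \<sigma> *\<^sub>R ((d - \<sigma>) powr (1 - \<gamma>) / (1 - \<gamma>))"
        by (simp split: split_indicator)
    qed
    show "integrable lborel (\<lambda>\<sigma>. \<integral>s. norm (case_prod K (\<sigma>, s)) \<partial>lborel)"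
      unfolding eq using \<gamma>
      by (intro borel_integrable_compact) (auto intro!: continuous_intros continuous_on_powr')
    show "AE \<sigma> in lborel. integrable lborel (\<lambda>s. case_prod K (\<sigma>, s))"
      using K1 by (auto simp: has_bochner_integral_iff)
  qed simp
  obtain B1 where B1: "\<And>x. x \<in> {c..d} \<Longrightarrow> norm (f x) \<le> B1"
    using compact_imp_bounded[OF compact_continuous_image[OF f compact_Icc]]
    unfolding bounded_iff by blast
  obtain B2 where B2: "\<And>x. x \<in> {c..d} \<Longrightarrow> norm (h x) \<le> B2"
    using compact_imp_bounded[OF compact_continuous_image[OF h compact_Icc]]
    unfolding bounded_iff by blast
  \<comment> \<open>Both functions are bounded on the compact interval, so a constant multiple of
    the kernel dominates the full integrand.\<close>
  have bd: "norm (k \<sigma> s) \<le> norm (K \<sigma> s * (B2 * B1))" for \<sigma> s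
  proof (cases "c \<le> \<sigma> \<and> \<sigma> \<le> s \<and> s \<le> d")
    case True
    have "\<bar>h \<sigma>\<bar> * \<bar>f s\<bar> \<le> B2 * B1"
      using True B1[of s] B2[of \<sigma>] by (intro mult_mono) auto
    then have "\<bar>h \<sigma>\<bar> * \<bar>f s\<bar> \<le> \<bar>B2 * B1\<bar>" by linarith
    with True show ?thesis
      by (simp add: k_def K_def F_def G_def abs_mult mult_left_mono)
  qed (auto simp: k_def K_def)
  have intk: "integrable (lborel \<Otimes>\<^sub>M lborel) (case_prod k)"
    by (rule Bochner_Integration.integrable_bound[where f="\<lambda>x. case_prod K x * (B2 * B1)"])
       (use intK bd in auto)
  have k1: "integrable lborel (k \<sigma>)" for \<sigma>
    by (rule Bochner_Integration.integrable_bound[where f="\<lambda>s. K \<sigma> s * (B2 * B1)"])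
       (use K1[of \<sigma>] bd in \<open>auto simp: has_bochner_integral_iff\<close>)
  have k2: "integrable lborel (\<lambda>\<sigma>. k \<sigma> s)" for s
    by (rule Bochner_Integration.integrable_bound[where f="\<lambda>\<sigma>. K \<sigma> s * (B2 * B1)"])
       (use K2[of s] bd in \<open>auto simp: has_bochner_integral_iff\<close>)
  have e1: "(\<integral>s. k \<sigma> s \<partial>lborel) =
      (if \<sigma> \<in> {c..d} then h \<sigma> * integral {\<sigma>..d} (\<lambda>s. (s - \<sigma>) powr (- \<gamma>) * f s) else 0)" for \<sigma>
  proof -
    have "(\<integral>s. k \<sigma> s \<partial>lborel) = integral UNIV (k \<sigma>)"
      using integral_lborel[OF k1] by simp
    also have "\<dots> = integral UNIV (\<lambda>s. if s \<in> {\<sigma>..d} then G \<sigma> * ((s - \<sigma>) powr (- \<gamma>) * f s) else 0)"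
      by (rule integral_cong) (auto simp: k_def K_def F_def G_def split: split_indicator)
    also have "\<dots> = G \<sigma> * integral {\<sigma>..d} (\<lambda>s. (s - \<sigma>) powr (- \<gamma>) * f s)"
      by (simp only: integral_restrict_UNIV integral_mult_right)
    finally show ?thesis by (simp add: G_def)
  qed
  have e2: "(\<integral>\<sigma>. k \<sigma> s \<partial>lborel) =
      (if s \<in> {c..d} then f s * integral {c..s} (\<lambda>\<sigma>. (s - \<sigma>) powr (- \<gamma>) * h \<sigma>) else 0)" for s
  proof -
    have "(\<integral>\<sigma>. k \<sigma> s \<partial>lborel) = integral UNIV (\<lambda>\<sigma>. k \<sigma> s)"
      using integral_lborel[OF k2] by simp
    also have "\<dots> = integral UNIV (\<lambda>\<sigma>. if \<sigma> \<in> {c..s} then F s * ((s - \<sigma>) powr (- \<gamma>) * h \<sigma>) else 0)"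
      by (rule integral_cong) (auto simp: k_def K_def F_def G_def split: split_indicator)
    also have "\<dots> = F s * integral {c..s} (\<lambda>\<sigma>. (s - \<sigma>) powr (- \<gamma>) * h \<sigma>)"
      by (simp only: integral_restrict_UNIV integral_mult_right)
    finally show ?thesis by (simp add: F_def)
  qed
  have "integral UNIV (\<lambda>s. \<integral>\<sigma>. k \<sigma> s \<partial>lborel) = integral UNIV (\<lambda>\<sigma>. \<integral>s. k \<sigma> s \<partial>lborel)"
    using lborel_pair.Fubini_integral[OF intk] integral_lborel[OF lborel_pair.integrable_fst[OF intk]]
      integral_lborel[OF lborel_pair.integrable_snd[OF intk]]
    by simp
  then show ?thesis
    by (simp only: e1 e2 integral_restrict_UNIV)
qed

text \<open>Replaces the derivative chosen by \<open>vector_derivative\<close> by a given one.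
  Uniqueness of the derivative within \<open>{c..d}\<close>, endpoints included, rests on
  \<open>c < d\<close>.\<close>

lemma caputo_left_eq:
  assumes "c < d" "s \<in> {c..d}"
    and "\<And>\<sigma>. \<sigma> \<in> {c..d} \<Longrightarrow> (f has_real_derivative f' \<sigma>) (at \<sigma> within {c..d})"
  shows "caputo_left c d \<gamma> f s =
    1 / Gamma (1 - \<gamma>) * integral {c..s} (\<lambda>\<sigma>. (s - \<sigma>) powr (- \<gamma>) * f' \<sigma>)"
proof -
  have "vector_derivative f (at \<sigma> within {c..d}) = f' \<sigma>" if "\<sigma> \<in> {c..s}" for \<sigma>
    using assms that
    by (intro vector_derivative_within_cbox[of c d, simplified])
       (auto simp flip: has_real_derivative_iff_has_vector_derivative)
  then show ?thesis
    unfolding caputo_left_def by (auto intro!: arg_cong2[where f="(*)"] integral_cong)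
qed

text \<open>\<open>RL_right_exists\<close> says that the fractional integral \<open>J\<close> of
  \<open>f\<close> is differentiable on the closed interval, so the fundamental theorem applies to
  \<open>\<phi> * J\<close>; both boundary terms carry a factor \<phi>. The kernel swap with
  \<open>\<phi>'\<close> in place of \<open>h\<close> brings \<open>J\<close> into the left-hand
  side.\<close>

lemma fractional_integration_by_parts:
  assumes \<gamma>: "\<gamma> < 1" and cd: "c < d"
    and f: "continuous_on {c..d} f"
    and \<phi>: "\<And>s. s \<in> {c..d} \<Longrightarrow> (\<phi> has_real_derivative \<phi>' s) (at s within {c..d})"
    and \<phi>': "continuous_on {c..d} \<phi>'" and zero: "\<phi> c = 0" "\<phi> d = 0"
    and ex: "\<And>s. s \<in> {c..d} \<Longrightarrow> RL_right_exists c d \<gamma> f s"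
    and cont: "continuous_on {c..d} (RL_right c d \<gamma> f)"
  shows "integral {c..d} (\<lambda>s. f s * caputo_left c d \<gamma> \<phi> s) =
         integral {c..d} (\<lambda>s. RL_right c d \<gamma> f s * \<phi> s)"
proof -
  define J where "J = RL_right_int d \<gamma> f"
  have Gam: "Gamma (1 - \<gamma>) > 0" using \<gamma> by (simp add: Gamma_real_pos)
  have J: "(J has_real_derivative - Gamma (1 - \<gamma>) * RL_right c d \<gamma> f s) (at s within {c..d})"
    if "s \<in> {c..d}" for s
    using ex[OF that] Gam
    by (simp add: RL_right_exists_def RL_right_def J_def vector_derivative_works
          has_real_derivative_iff_has_vector_derivative)
  have contJ: "continuous_on {c..d} J" and cont\<phi>: "continuous_on {c..d} \<phi>"
    using J \<phi> by (meson DERIV_continuous continuous_on_eq_continuous_within)+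
  have "((\<lambda>s. \<phi>' s * J s + \<phi> s * (- Gamma (1 - \<gamma>) * RL_right c d \<gamma> f s))
      has_integral \<phi> d * J d - \<phi> c * J c) {c..d}"
    using cd
    by (intro fundamental_theorem_of_calculus)
       (auto simp flip: has_real_derivative_iff_has_vector_derivative
          intro!: derivative_eq_intros \<phi> J)
  then have "integral {c..d} (\<lambda>s. \<phi>' s * J s - Gamma (1 - \<gamma>) * (RL_right c d \<gamma> f s * \<phi> s)) = 0"
    using zero by (simp add: integral_unique algebra_simps)
  moreover have "integral {c..d} (\<lambda>s. \<phi>' s * J s - Gamma (1 - \<gamma>) * (RL_right c d \<gamma> f s * \<phi> s)) =
     integral {c..d} (\<lambda>s. \<phi>' s * J s) - Gamma (1 - \<gamma>) * integral {c..d} (\<lambda>s. RL_right c d \<gamma> f s * \<phi> s)"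
    using contJ cont\<phi> \<phi>' cont
    by (subst Henstock_Kurzweil_Integration.integral_diff)
       (auto intro!: integrable_continuous_real continuous_intros)
  ultimately have *: "integral {c..d} (\<lambda>s. \<phi>' s * J s) =
      Gamma (1 - \<gamma>) * integral {c..d} (\<lambda>s. RL_right c d \<gamma> f s * \<phi> s)" by simp
  have "integral {c..d} (\<lambda>s. f s * caputo_left c d \<gamma> \<phi> s) =
    integral {c..d} (\<lambda>s. 1 / Gamma (1 - \<gamma>) * (f s * integral {c..s} (\<lambda>\<sigma>. (s - \<sigma>) powr (- \<gamma>) * \<phi>' \<sigma>)))"
    using caputo_left_eq[OF cd _ \<phi>] by (intro integral_cong) auto
  also have "\<dots> = 1 / Gamma (1 - \<gamma>) * integral {c..d} (\<lambda>s. \<phi>' s * J s)"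
    unfolding integral_mult_right J_def RL_right_int_def powr_kernel_swap[OF \<gamma> f \<phi>'] ..
  finally show ?thesis using * Gam by simp
qed

section \<open>Bumps and their Caputo derivatives\<close>

text \<open>Away from 0 the function agrees locally with a power or with 0. At 0 the difference
  quotient is \<open>max 0 h ^ (n + 1)\<close>, which tends to 0 because its exponent is
  positive.\<close>

lemma DERIV_max_zero_power:
  "((\<lambda>x::real. max 0 x ^ (n + 2)) has_real_derivative real (n + 2) * max 0 x ^ (n + 1)) (at x)"
proof -
  consider "x > 0" | "x < 0" | "x = 0" by linarith
  then show ?thesis
  proof cases
    case 1
    have "((\<lambda>x::real. x ^ (n + 2)) has_real_derivative real (n + 2) * max 0 x ^ (n + 1)) (at x)"
      using 1 DERIV_pow[of "n + 2" x] by simp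
    then show ?thesis
      by (rule has_field_derivative_transform_within_open[of _ _ _ "{0<..}"]) (use 1 in auto)
  next
    case 2
    have "((\<lambda>x::real. 0) has_real_derivative real (n + 2) * max 0 x ^ (n + 1)) (at x)"
      using 2 by (auto intro!: derivative_eq_intros)
    then show ?thesis
      by (rule has_field_derivative_transform_within_open[of _ _ _ "{..<0}"]) (use 2 in auto)
  next
    case 3
    have "((\<lambda>h::real. max 0 h ^ (n + 1)) \<longlongrightarrow> max 0 0 ^ (n + 1)) (at 0)"
      by (intro tendsto_intros)
    then have "((\<lambda>h::real. max 0 h ^ (n + 1)) \<longlongrightarrow> 0) (at 0)" by simp
    then have "((\<lambda>h::real. max 0 h ^ (n + 2) / h) \<longlongrightarrow> 0) (at 0)"
      by (rule Lim_transform_eventually)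
         (auto simp: eventually_at_filter max_def)
    with 3 show ?thesis by (simp add: DERIV_def)
  qed
qed

lemma DERIV_max_zero_power_compose:
  assumes "(g has_real_derivative m) (at x)" "n \<ge> 2"
  shows "((\<lambda>x. max 0 (g x) ^ n) has_real_derivative real n * max 0 (g x) ^ (n - 1) * m) (at x)"
proof -
  obtain k where k: "n = k + 2" using assms(2) by (metis add.commute le_Suc_ex)
  show ?thesis using DERIV_chain2[OF DERIV_max_zero_power[of k "g x"] assms(1)] k by simp
qed

text \<open>One integration by parts turns the singular kernel into the continuous kernel
  \<open>\<tau> powr (1 - \<gamma>)\<close>; after the substitution \<open>\<tau> = s - \<sigma>\<close> the upper limit may be
  frozen at \<open>d - c\<close>, since \<open>\<phi>\<close> is constant left of \<open>c\<close>, and one differentiates under the integral.\<close>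

lemma caputo_left_smooth:
  fixes \<phi> :: "real \<Rightarrow> real"
  assumes \<gamma>: "\<gamma> < 1" and cd: "c < d"
    and d1: "\<And>s. (\<phi> has_real_derivative \<phi>1 s) (at s)"
    and d2: "\<And>s. (\<phi>1 has_real_derivative \<phi>2 s) (at s)"
    and d3: "\<And>s. (\<phi>2 has_real_derivative \<phi>3 s) (at s)"
    and c3: "continuous_on UNIV \<phi>3"
    and zero: "\<And>s. s \<le> c \<Longrightarrow> \<phi>1 s = 0" "\<And>s. s \<le> c \<Longrightarrow> \<phi>2 s = 0"
  obtains D D' where "\<And>s. (D has_real_derivative D' s) (at s)" "continuous_on UNIV D'"
    "\<And>s. s \<in> {c..d} \<Longrightarrow> caputo_left c d \<gamma> \<phi> s = D s"
proof -
  \<comment> \<open>This is \<open>1 / Gamma (2 - \<gamma>)\<close>: the second factor comes from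
    integrating the kernel once.\<close>
  define A where "A = 1 / Gamma (1 - \<gamma>) * (1 / (1 - \<gamma>))"
  define D where "D = (\<lambda>s. A * integral {0..d - c} (\<lambda>\<tau>. \<tau> powr (1 - \<gamma>) * \<phi>2 (s - \<tau>)))"
  define D' where "D' = (\<lambda>s. A * integral {0..d - c} (\<lambda>\<tau>. \<tau> powr (1 - \<gamma>) * \<phi>3 (s - \<tau>)))"
  have c2: "continuous_on S \<phi>2" and c1: "continuous_on S \<phi>1" for S
    using d3 d2 by (meson DERIV_isCont continuous_at_imp_continuous_on)+
  have pw: "continuous_on {0..l} (\<lambda>\<tau>. \<tau> powr (1 - \<gamma>))" for l
    using \<gamma> by (intro continuous_on_powr' continuous_intros) auto
  have pw2: "continuous_on (S \<times> {0..l}) (\<lambda>y. snd y powr (1 - \<gamma>))" for l and S :: "real set"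
    by (rule continuous_on_compose2[OF pw[of l]]) (auto intro!: continuous_intros)
  have i2: "continuous_on S (\<lambda>\<tau>. \<phi>2 (s - \<tau>))" for S s
    by (rule continuous_on_compose2[OF c2[of UNIV]]) (auto intro!: continuous_intros)
  have cont: "continuous_on (UNIV \<times> cbox 0 (d - c)) (\<lambda>(s, \<tau>). \<tau> powr (1 - \<gamma>) * \<phi>3 (s - \<tau>))"
    unfolding case_prod_beta box_real
    by (intro continuous_intros pw2 continuous_on_compose2[OF c3]) auto
  have "(D has_real_derivative D' s) (at s)" for s
    unfolding D_def D'_def
  proof (rule DERIV_cmult, rule leibniz_rule_field_derivative[where U=UNIV and a=0 and b="d - c", simplified])
    show "((\<lambda>x. t powr (1 - \<gamma>) * \<phi>2 (x - t)) has_real_derivative t powr (1 - \<gamma>) * \<phi>3 (x - t)) (at x)" for x t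
      by (auto intro!: derivative_eq_intros DERIV_chain2[OF d3])
    show "(\<lambda>\<tau>. \<tau> powr (1 - \<gamma>) * \<phi>2 (x - \<tau>)) integrable_on {0..d - c}" for x
      by (intro integrable_continuous_real continuous_intros pw i2)
    show "continuous_on (UNIV \<times> {0..d - c}) (\<lambda>(s, \<tau>). \<tau> powr (1 - \<gamma>) * \<phi>3 (s - \<tau>))"
      using cont by simp
  qed
  moreover have "continuous_on UNIV D'"
    unfolding D'_def using integral_continuous_on_param[OF cont] by (intro continuous_intros) simp
  moreover have "caputo_left c d \<gamma> \<phi> s = D s" if s: "s \<in> {c..d}" for s
  proof -
    let ?k = "\<lambda>\<tau>. \<tau> powr (1 - \<gamma>) * \<phi>2 (s - \<tau>)"
    have int: "?k integrable_on {0..l}" for l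
      by (intro integrable_continuous_real continuous_intros pw i2)
    \<comment> \<open>Neither boundary term contributes: at \<open>s\<close> the power vanishes
      since its exponent is positive, and at \<open>c\<close> the factor \<open>\<phi>1 c\<close> is
      0.\<close>
    have "((\<lambda>\<sigma>. (s - \<sigma>) powr (1 - \<gamma>) * \<phi>2 \<sigma> - (1 - \<gamma>) * ((s - \<sigma>) powr (- \<gamma>) * \<phi>1 \<sigma>)) has_integral
        (s - s) powr (1 - \<gamma>) * \<phi>1 s - (s - c) powr (1 - \<gamma>) * \<phi>1 c) {c..s}"
    proof (rule fundamental_theorem_of_calculus_interior)
      show "continuous_on {c..s} (\<lambda>\<sigma>. (s - \<sigma>) powr (1 - \<gamma>) * \<phi>1 \<sigma>)"
        using \<gamma> by (intro continuous_intros c1 continuous_on_powr') auto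
      show "((\<lambda>\<sigma>. (s - \<sigma>) powr (1 - \<gamma>) * \<phi>1 \<sigma>) has_vector_derivative
         (s - x) powr (1 - \<gamma>) * \<phi>2 x - (1 - \<gamma>) * ((s - x) powr (- \<gamma>) * \<phi>1 x)) (at x)"
        if "x \<in> {c<..<s}" for x
      proof -
        have "((\<lambda>\<sigma>. (s - \<sigma>) powr (1 - \<gamma>)) has_real_derivative - ((1 - \<gamma>) * (s - x) powr (- \<gamma>))) (at x)"
          using that by (intro DERIV_fun_powr[THEN DERIV_cong]) (auto intro!: derivative_eq_intros)
        from DERIV_mult[OF this d2[of x]] show ?thesis
          unfolding has_real_derivative_iff_has_vector_derivative[symmetric]
          by (rule DERIV_cong) (simp add: algebra_simps)
      qed
    qed (use s in auto)
    then have "integral {c..s} (\<lambda>\<sigma>. (s - \<sigma>) powr (1 - \<gamma>) * \<phi>2 \<sigma> - (1 - \<gamma>) * ((s - \<sigma>) powr (- \<gamma>) * \<phi>1 \<sigma>)) = 0"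
      by (simp add: integral_unique zero)
    moreover have "(\<lambda>\<sigma>. (s - \<sigma>) powr (1 - \<gamma>) * \<phi>2 \<sigma>) integrable_on {c..s}"
      using \<gamma> by (intro integrable_continuous_real continuous_intros c2 continuous_on_powr') auto
    ultimately have 1: "(1 - \<gamma>) * integral {c..s} (\<lambda>\<sigma>. (s - \<sigma>) powr (- \<gamma>) * \<phi>1 \<sigma>) =
        integral {c..s} (\<lambda>\<sigma>. (s - \<sigma>) powr (1 - \<gamma>) * \<phi>2 \<sigma>)"
      using powr_kernel_left_integrable[OF \<gamma> c1]
      by (simp add: Henstock_Kurzweil_Integration.integral_diff integrable_on_mult_right)
    have "(?k has_integral integral {0..s - c} ?k) (cbox 0 (s - c))"
      using int by (simp add: integrable_integral)
    from has_integral_affinity[OF this, of "-1" s]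
    have "((\<lambda>\<sigma>. (s - \<sigma>) powr (1 - \<gamma>) * \<phi>2 \<sigma>) has_integral integral {0..s - c} ?k) ((\<lambda>x. s - x) ` {0..s - c})"
      by simp
    also have "(\<lambda>x. s - x) ` {0..s - c} = {c..s}"
      using s by simp
    finally have 2: "integral {c..s} (\<lambda>\<sigma>. (s - \<sigma>) powr (1 - \<gamma>) * \<phi>2 \<sigma>) = integral {0..s - c} ?k"
      by (rule integral_unique)
    \<comment> \<open>For \<open>\<tau> \<ge> s - c\<close> the argument \<open>s - \<tau>\<close>
      is at most \<open>c\<close>, where \<open>\<phi>2\<close> vanishes; extending the range to
      \<open>d - c\<close> therefore changes nothing.\<close>
    have "integral {s - c..d - c} ?k = integral {s - c..d - c} (\<lambda>_. 0)"
      by (intro integral_cong) (simp add: zero)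
    then have 3: "integral {0..s - c} ?k = integral {0..d - c} ?k"
      using Henstock_Kurzweil_Integration.integral_combine[of 0 "s - c" "d - c" ?k] s int by simp
    have "integral {c..s} (\<lambda>\<sigma>. (s - \<sigma>) powr (- \<gamma>) * \<phi>1 \<sigma>) = 1 / (1 - \<gamma>) * integral {0..d - c} ?k"
      using \<gamma> unfolding 3[symmetric] 2[symmetric] 1[symmetric] by simp
    then show ?thesis
      unfolding caputo_left_eq[OF cd s has_field_derivative_at_within[OF d1]] D_def A_def by simp
  qed
  ultimately show ?thesis using that by blast
qed

text \<open>The exponent 4 makes the bump three times continuously differentiable, as
  the lemma above needs.\<close>

definition bump :: "real \<Rightarrow> real \<Rightarrow> real \<Rightarrow> real" where
  "bump p q s = max 0 ((s - p) * (q - s)) ^ 4"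

lemma bump_nonneg: "0 \<le> bump p q s"
  by (simp add: bump_def)

lemma bump_eq_0: "p < q \<Longrightarrow> s \<notin> {p<..<q} \<Longrightarrow> bump p q s = 0"
  using mult_nonpos_nonneg[of "s - p" "q - s"] mult_nonneg_nonpos[of "s - p" "q - s"]
  by (auto simp: bump_def max_absorb1)

lemma bump_pos: "s \<in> {p<..<q} \<Longrightarrow> 0 < bump p q s"
  by (auto simp: bump_def max_def zero_less_mult_iff mult_le_0_iff)

text \<open>\<open>p + q - 2 * s\<close> is the derivative of \<open>(s - p) * (q - s)\<close>. Each
  differentiation lowers the power of the cut-off by at most one, so \<open>\<phi>3\<close> still
  has it to the first power in its first term and is continuous.\<close>

lemma bump_derivs:
  fixes p q :: real
  defines "\<phi>1 \<equiv> \<lambda>s. 4 * max 0 ((s - p) * (q - s)) ^ 3 * (p + q - 2 * s)"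
    and "\<phi>2 \<equiv> \<lambda>s. 12 * max 0 ((s - p) * (q - s)) ^ 2 * (p + q - 2 * s)\<^sup>2 - 8 * max 0 ((s - p) * (q - s)) ^ 3"
    and "\<phi>3 \<equiv> \<lambda>s. 24 * max 0 ((s - p) * (q - s)) * (p + q - 2 * s) ^ 3 - 72 * max 0 ((s - p) * (q - s)) ^ 2 * (p + q - 2 * s)"
  shows "(bump p q has_real_derivative \<phi>1 s) (at s)"
    "(\<phi>1 has_real_derivative \<phi>2 s) (at s)"
    "(\<phi>2 has_real_derivative \<phi>3 s) (at s)"
proof -
  define w where "w = (\<lambda>s. (s - p) * (q - s))"
  have w: "(w has_real_derivative (p + q - 2 * s)) (at s)"
    unfolding w_def by (auto intro!: derivative_eq_intros)
  note m = DERIV_max_zero_power_compose[OF w]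
  have l: "((\<lambda>s. p + q - 2 * s) has_real_derivative - 2) (at s)"
    by (auto intro!: derivative_eq_intros)
  have l2: "((\<lambda>s. (p + q - 2 * s)\<^sup>2) has_real_derivative - 4 * (p + q - 2 * s)) (at s)"
    by (auto intro!: derivative_eq_intros)
  show "(bump p q has_real_derivative \<phi>1 s) (at s)"
    using m[of 4] unfolding \<phi>1_def bump_def[abs_def] w_def by simp
  have "(\<phi>1 has_real_derivative 4 * (3 * max 0 (w s) ^ 2 * (p + q - 2 * s)) * (p + q - 2 * s) +
      - 2 * (4 * max 0 (w s) ^ 3)) (at s)"
    using DERIV_mult[OF DERIV_cmult[OF m[of 3], of 4] l] unfolding \<phi>1_def w_def by simp
  then show "(\<phi>1 has_real_derivative \<phi>2 s) (at s)"
    by (rule DERIV_cong) (simp add: \<phi>2_def w_def power2_eq_square)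
  have "(\<phi>2 has_real_derivative (12 * (2 * max 0 (w s) * (p + q - 2 * s)) * (p + q - 2 * s)\<^sup>2 +
      - 4 * (p + q - 2 * s) * (12 * max 0 (w s) ^ 2)) - 8 * (3 * max 0 (w s) ^ 2 * (p + q - 2 * s))) (at s)"
    using DERIV_diff[OF DERIV_mult[OF DERIV_cmult[OF m[of 2], of 12] l2] DERIV_cmult[OF m[of 3], of 8]]
    unfolding \<phi>2_def w_def by simp
  then show "(\<phi>2 has_real_derivative \<phi>3 s) (at s)"
    by (rule DERIV_cong) (unfold \<phi>3_def w_def, algebra)
qed

lemma bump_C1: "\<exists>\<phi>'. (\<forall>s. (bump p q has_real_derivative \<phi>' s) (at s)) \<and> continuous_on UNIV \<phi>'"
  using bump_derivs(1,2)[of p q]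
  by (intro exI[of _ "\<lambda>s. 4 * max 0 ((s - p) * (q - s)) ^ 3 * (p + q - 2 * s)"])
     (auto intro!: continuous_intros)

text \<open>The Caputo derivative looks only to the left, so what matters is that the bump begins at
  or after \<open>c\<close>: then its first two derivatives vanish up to \<open>c\<close>.\<close>

lemma caputo_left_bump:
  assumes \<gamma>: "\<gamma> < 1" and cd: "c < d" and p: "c \<le> p" "p < q"
  obtains D D' where "\<And>s. (D has_real_derivative D' s) (at s)" "continuous_on UNIV D'"
    "\<And>s. s \<in> {c..d} \<Longrightarrow> caputo_left c d \<gamma> (bump p q) s = D s"
proof -
  have max0: "max 0 ((s - p) * (q - s)) = 0" if "s \<le> c" for s
    using that p by (auto simp: max_def zero_le_mult_iff)
  show ?thesis
    by (rule caputo_left_smooth[OF \<gamma> cd bump_derivs[of p q]])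
       (auto intro!: continuous_intros simp: max0, use that in auto)
qed

section \<open>Slices of the box\<close>

lemma xupd_nth [simp]: "xupd x i s $ k = (if k = i then s else x $ k)"
  by (simp add: xupd_def)

lemma xupd_same [simp]: "xupd x i (x $ i) = x"
  by (simp add: vec_eq_iff)

text \<open>Exhibits a slice as an affine line, which makes continuity and differentiation along it
  mechanical.\<close>

lemma xupd_eq_add_axis: "xupd x i s = x + (s - x $ i) *\<^sub>R axis i 1"
  by (simp add: vec_eq_iff axis_def)

lemma continuous_on_xupd [continuous_intros]:
  assumes "continuous_on S f" "continuous_on S g"
  shows "continuous_on S (\<lambda>y. xupd (f y) i (g y))"
  unfolding xupd_eq_add_axis
  by (intro continuous_intros assms continuous_on_compose2[OF linear_continuous_on[OF bounded_linear_vec_nth] assms(1)]) auto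

text \<open>The exchange of the scalar variable with the \<open>i\<close>-th component is a
  continuous involution that maps boxes to boxes of equal volume, so it preserves integrals.\<close>

lemma has_integral_swap_component:
  fixes k :: "real \<times> (real^'n) \<Rightarrow> real"
  assumes "(k has_integral I) (cbox (p, u) (q, v))"
  shows "((\<lambda>(s, x). k (x $ i, xupd x i s)) has_integral I) (cbox (u $ i, xupd u i p) (v $ i, xupd v i q))"
proof -
  define T :: "real \<times> (real^'n) \<Rightarrow> real \<times> (real^'n)" where "T = (\<lambda>(s, x). (x $ i, xupd x i s))"
  have TT: "T (T y) = y" for y
    by (cases y) (simp add: T_def vec_eq_iff)
  have mem: "(s, x) \<in> cbox (p, u) (q, v) \<longleftrightarrow> p \<le> s \<and> s \<le> q \<and> (\<forall>k. u $ k \<le> x $ k \<and> x $ k \<le> v $ k)"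
    for s p q :: real and x u v :: "real^'n"
    by (auto simp: cbox_Pair_eq mem_box_cart)
  have Tmem: "T y \<in> cbox (u $ i, xupd u i p) (v $ i, xupd v i q) \<longleftrightarrow> y \<in> cbox (p, u) (q, v)" for y p q u v
  proof (cases y)
    case (Pair s x)
    have "(\<forall>k. (if k = i then p else u $ k) \<le> (if k = i then s else x $ k) \<and>
        (if k = i then s else x $ k) \<le> (if k = i then q else v $ k)) \<longleftrightarrow>
      p \<le> s \<and> s \<le> q \<and> (\<forall>k. k \<noteq> i \<longrightarrow> u $ k \<le> x $ k \<and> x $ k \<le> v $ k)"
      by auto
    then show ?thesis
      unfolding Pair T_def prod.case mem xupd_nth by metis
  qed
  have img: "T ` cbox (p, u) (q, v) = cbox (u $ i, xupd u i p) (v $ i, xupd v i q)" for p q u v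
  proof (intro set_eqI iffI)
    fix y assume "y \<in> cbox (u $ i, xupd u i p) (v $ i, xupd v i q)"
    then have "T y \<in> cbox (p, u) (q, v)" using Tmem[of "T y" u p v q] by (simp add: TT)
    then show "y \<in> T ` cbox (p, u) (q, v)" using TT[of y] by (metis imageI)
  next
    fix y assume "y \<in> T ` cbox (p, u) (q, v)"
    then obtain x where "y = T x" "x \<in> cbox (p, u) (q, v)" by (rule imageE)
    then show "y \<in> cbox (u $ i, xupd u i p) (v $ i, xupd v i q)" by (simp only: Tmem)
  qed
  have ex: "\<exists>w z. T ` cbox u v = cbox w z" for u v
    by (cases u; cases v) (auto simp only: img)
  \<comment> \<open>The exchange moves one side length from one factor of the volume to the other.
    Empty boxes are treated apart because the product formula for the content presupposes nonempty
    ones.\<close>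
  have cont: "measure lborel (T ` cbox u v) = 1 * measure lborel (cbox u v)" for u v
  proof (cases "cbox u v = {}")
    case False
    obtain p u' q v' where uv: "u = (p, u')" "v = (q, v')" by (cases u; cases v)
    have ne: "cbox (u' $ i) (v' $ i) \<noteq> {}" "cbox (xupd u' i p) (xupd v' i q) \<noteq> {}"
      "cbox p q \<noteq> {}" "cbox u' v' \<noteq> {}"
      using False unfolding uv img[symmetric] cbox_Pair_eq
      using img[of p u' q v'] by (auto simp: cbox_Pair_eq)
    have "(v' $ i - u' $ i) * (\<Prod>k\<in>UNIV. (if k = i then q else v' $ k) - (if k = i then p else u' $ k)) =
      (q - p) * (\<Prod>k\<in>UNIV. v' $ k - u' $ k)"
      by (simp add: prod.remove[of UNIV i] algebra_simps)
    then show ?thesis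
      using ne unfolding uv img content_Pair
      by (simp add: content_cbox_cart content_real)
  qed simp
  have "((\<lambda>y. k (T y)) has_integral (1 / 1) *\<^sub>R I) (T ` cbox (p, u) (q, v))"
  proof (rule has_integral_twiddle[OF _ TT TT _ ex ex cont assms])
    show "continuous (at y) T" for y
    proof -
      have "continuous_on UNIV T"
        unfolding T_def case_prod_beta
        by (intro continuous_intros linear_continuous_on bounded_linear_compose[OF bounded_linear_vec_nth bounded_linear_snd])
      then show ?thesis by (metis UNIV_I continuous_on_eq_continuous_at open_UNIV)
    qed
  qed auto
  then show ?thesis by (simp add: img) (simp add: T_def case_prod_unfold)
qed

lemma xupd_in_cbox:
  assumes "x \<in> cbox aa bb" "s \<in> {aa $ i..bb $ i}"
  shows "xupd x i s \<in> cbox aa bb"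
  using assms by (auto simp: mem_box_cart)

text \<open>Fubini in a single coordinate of a vector: average over a dummy variable and
  exchange it with the \<open>i\<close>-th component, which preserves volume.\<close>

lemma integral_cbox_slice:
  fixes k :: "real^'n \<Rightarrow> real"
  assumes k: "continuous_on (cbox aa bb) k" and i: "aa $ i \<le> bb $ i"
  shows "(bb $ i - aa $ i) * integral (cbox aa bb) k =
    integral (cbox aa bb) (\<lambda>x. integral {aa $ i..bb $ i} (\<lambda>s. k (xupd x i s)))"
proof -
  let ?Q = "cbox (aa $ i, aa) (bb $ i, bb)"
  have c1: "continuous_on ?Q (\<lambda>(s, x). k x)"
    unfolding case_prod_beta
    by (intro continuous_on_compose2[OF k] continuous_intros) (auto simp: cbox_Pair_eq)
  have c2: "continuous_on ?Q (\<lambda>(s, x). k (xupd x i s))"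
    unfolding case_prod_beta
    by (intro continuous_on_compose2[OF k] continuous_intros) (auto simp: cbox_Pair_eq intro!: xupd_in_cbox)
  have "((\<lambda>(s, x). k x) has_integral integral ?Q (\<lambda>(s, x). k x)) ?Q"
    using c1 by (intro integrable_integral integrable_continuous)
  \<comment> \<open>The box is its own image, because the dummy variable runs over the
    \<open>i\<close>-th side.\<close>
  from has_integral_swap_component[OF this, of i]
  have "integral ?Q (\<lambda>(s, x). k (xupd x i s)) = integral ?Q (\<lambda>(s, x). k x)"
    by (auto simp: integral_unique)
  moreover have "integral ?Q (\<lambda>(s, x). k x) = (bb $ i - aa $ i) * integral (cbox aa bb) k"
    using integral_prod_continuous[OF c1] i by simp
  moreover have "integral ?Q (\<lambda>(s, x). k (xupd x i s)) =
      integral (cbox aa bb) (\<lambda>x. integral {aa $ i..bb $ i} (\<lambda>s. k (xupd x i s)))"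
    using integral_prod_continuous[OF c2] integral_swap_continuous[of "aa $ i" aa "bb $ i" bb "\<lambda>s x. k (xupd x i s)"] c2
    by simp
  ultimately show ?thesis by simp
qed

text \<open>With constant velocity \<open>v\<close> the derivative along the curve is
  \<open>F (w s) v\<close>, again continuous in \<open>s\<close>. Slices in time and in a space
  coordinate are such curves.\<close>

lemma C1_on_affine_curve:
  fixes f :: "'a::real_normed_vector \<Rightarrow> real"
  assumes f: "C1_on S f"
    and w: "\<And>s. s \<in> T \<Longrightarrow> w s \<in> S" "\<And>s. s \<in> T \<Longrightarrow> (w has_vector_derivative v) (at s within T)"
  obtains f' where "\<And>s. s \<in> T \<Longrightarrow> ((\<lambda>s. f (w s)) has_real_derivative f' s) (at s within T)"
    "continuous_on T f'"
proof -
  obtain F where F: "\<And>p. p \<in> S \<Longrightarrow> (f has_derivative blinfun_apply (F p)) (at p within S)"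
    and cF: "continuous_on S F"
    using f unfolding C1_on_def by blast
  have cw: "continuous_on T w"
    unfolding continuous_on_eq_continuous_within using w(2) has_vector_derivative_continuous by blast
  have "((\<lambda>s. f (w s)) has_real_derivative F (w s) v) (at s within T)" if s: "s \<in> T" for s
  proof -
    have "((\<lambda>s. f (w s)) has_derivative (\<lambda>h. F (w s) (h *\<^sub>R v))) (at s within T)"
      by (rule has_derivative_in_compose2[of S f "\<lambda>p. blinfun_apply (F p)" w T s "\<lambda>h. h *\<^sub>R v"])
         (use F w s in \<open>auto simp: has_vector_derivative_def\<close>)
    then show ?thesis
      unfolding has_field_derivative_def
      by (rule has_derivative_eq_rhs) (simp add: fun_eq_iff blinfun.scaleR_right)
  qed
  moreover have "continuous_on T (\<lambda>s. F (w s) v)"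
    by (intro blinfun.continuous_on continuous_on_const continuous_on_compose2[OF cF cw]) (use w in auto)
  ultimately show ?thesis by (rule that)
qed

lemma mem_Pset: "(t, x) \<in> Pset a b aa bb \<longleftrightarrow> t \<in> {a..b} \<and> x \<in> cbox aa bb"
  by (simp add: Pset_def)

lemma Pset_eq_cbox: "Pset a b aa bb = cbox (a, aa) (b, bb)"
  by (simp add: Pset_def cbox_Pair_eq)

lemma interior_Pset: "interior (Pset a b aa bb) = {a<..<b} \<times> box aa bb"
  by (simp add: Pset_def interior_Times)

lemma frontier_Pset: "frontier (Pset a b aa bb) = Pset a b aa bb - {a<..<b} \<times> box aa bb"
proof -
  have "closed (Pset a b aa bb)" unfolding Pset_eq_cbox by (rule closed_cbox)
  then show ?thesis unfolding frontier_def interior_Pset by (simp only: closure_closed)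
qed

lemma C1_on_t_slice:
  assumes f: "C1_on (Pset a b aa bb) f" and x: "x \<in> cbox aa bb"
  obtains f' where
    "\<And>s. s \<in> {a..b} \<Longrightarrow> ((\<lambda>s. f (s, x)) has_real_derivative f' s) (at s within {a..b})"
    "continuous_on {a..b} f'"
proof (rule C1_on_affine_curve[OF f])
  show "(s, x) \<in> Pset a b aa bb" if "s \<in> {a..b}" for s
    using x that by (simp add: mem_Pset)
  show "((\<lambda>s. (s, x)) has_vector_derivative (1, 0)) (at s within {a..b})" for s
    unfolding has_vector_derivative_def
    by (rule has_derivative_eq_rhs, (rule derivative_intros)+) simp
qed (rule that)

lemma C1_on_x_slice:
  assumes f: "C1_on (Pset a b aa bb) f" and t: "t \<in> {a..b}" and x: "x \<in> cbox aa bb"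
  obtains f' where
    "\<And>s. s \<in> {aa $ i..bb $ i} \<Longrightarrow>
      ((\<lambda>s. f (t, xupd x i s)) has_real_derivative f' s) (at s within {aa $ i..bb $ i})"
    "continuous_on {aa $ i..bb $ i} f'"
proof (rule C1_on_affine_curve[OF f])
  show "(t, xupd x i s) \<in> Pset a b aa bb" if "s \<in> {aa $ i..bb $ i}" for s
    using t xupd_in_cbox[OF x that] by (simp add: mem_Pset)
  show "((\<lambda>s. (t, xupd x i s)) has_vector_derivative (0, axis i 1)) (at s within {aa $ i..bb $ i})" for s
    unfolding has_vector_derivative_def xupd_eq_add_axis
    by (rule has_derivative_eq_rhs, (rule derivative_intros)+) simp
qed (rule that)

section \<open>Linearity of the Caputo derivatives along a segment of variations\<close>

text \<open>The continuous derivatives make both integrands integrable against the singular kernel,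
  so that the integral of the sum may be split.\<close>

lemma caputo_left_add_cmult:
  assumes \<gamma>: "\<gamma> < 1" and cd: "c < d" and s: "s \<in> {c..d}"
    and f: "\<And>s. s \<in> {c..d} \<Longrightarrow> (f has_real_derivative f' s) (at s within {c..d})" "continuous_on {c..d} f'"
    and g: "\<And>s. s \<in> {c..d} \<Longrightarrow> (g has_real_derivative g' s) (at s within {c..d})" "continuous_on {c..d} g'"
  shows "caputo_left c d \<gamma> (\<lambda>s. f s + e * g s) s = caputo_left c d \<gamma> f s + e * caputo_left c d \<gamma> g s"
proof -
  have "((\<lambda>s. f s + e * g s) has_real_derivative f' s + e * g' s) (at s within {c..d})"
    if "s \<in> {c..d}" for s
    using f(1)[OF that] g(1)[OF that] by (auto intro!: derivative_eq_intros)
  then have e: "caputo_left c d \<gamma> (\<lambda>s. f s + e * g s) s =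
      1 / Gamma (1 - \<gamma>) * integral {c..s} (\<lambda>\<sigma>. (s - \<sigma>) powr (- \<gamma>) * (f' \<sigma> + e * g' \<sigma>))"
    by (rule caputo_left_eq[OF cd s])
  have sub: "{c..s} \<subseteq> {c..d}" using s by auto
  have i: "(\<lambda>\<sigma>. (s - \<sigma>) powr (- \<gamma>) * f' \<sigma>) integrable_on {c..s}"
    "(\<lambda>\<sigma>. (s - \<sigma>) powr (- \<gamma>) * g' \<sigma>) integrable_on {c..s}"
    by (rule powr_kernel_left_integrable[OF \<gamma> continuous_on_subset[OF f(2) sub]])
       (rule powr_kernel_left_integrable[OF \<gamma> continuous_on_subset[OF g(2) sub]])
  have "integral {c..s} (\<lambda>\<sigma>. (s - \<sigma>) powr (- \<gamma>) * (f' \<sigma> + e * g' \<sigma>)) =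
    integral {c..s} (\<lambda>\<sigma>. (s - \<sigma>) powr (- \<gamma>) * f' \<sigma> + e * ((s - \<sigma>) powr (- \<gamma>) * g' \<sigma>))"
    by (simp add: algebra_simps)
  also have "\<dots> = integral {c..s} (\<lambda>\<sigma>. (s - \<sigma>) powr (- \<gamma>) * f' \<sigma>) +
      e * integral {c..s} (\<lambda>\<sigma>. (s - \<sigma>) powr (- \<gamma>) * g' \<sigma>)"
    using i by (simp add: Henstock_Kurzweil_Integration.integral_add integrable_on_mult_right)
  finally show ?thesis
    unfolding e caputo_left_eq[OF cd s f(1), simplified] caputo_left_eq[OF cd s g(1), simplified]
    by (simp add: add_divide_distrib)
qed

lemma caputo_left_zero:
  assumes "c < d" "s \<in> {c..d}"
  shows "caputo_left c d \<gamma> (\<lambda>_. 0) s = 0"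
proof -
  have "caputo_left c d \<gamma> (\<lambda>_. 0) s = 1 / Gamma (1 - \<gamma>) * integral {c..s} (\<lambda>\<sigma>. (s - \<sigma>) powr (- \<gamma>) * 0)"
    by (rule caputo_left_eq[OF assms]) (rule DERIV_const)
  then show ?thesis by simp
qed

lemma caputo_left_cmult:
  assumes "\<gamma> < 1" "c < d" "s \<in> {c..d}"
    and "\<And>s. s \<in> {c..d} \<Longrightarrow> (g has_real_derivative g' s) (at s within {c..d})" "continuous_on {c..d} g'"
  shows "caputo_left c d \<gamma> (\<lambda>s. e * g s) s = e * caputo_left c d \<gamma> g s"
proof -
  have "caputo_left c d \<gamma> (\<lambda>s. 0 + e * g s) s = caputo_left c d \<gamma> (\<lambda>_. 0) s + e * caputo_left c d \<gamma> g s"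
    by (rule caputo_left_add_cmult[OF assms(1-3) _ _ assms(4,5), where f'="\<lambda>_. 0"]) auto
  then show ?thesis by (simp add: caputo_left_zero[OF assms(2,3)])
qed

lemma caputo_t_add_cmult:
  assumes "\<gamma> < 1" "a < b" "p \<in> Pset a b aa bb" "C1_on (Pset a b aa bb) f" "C1_on (Pset a b aa bb) g"
  shows "caputo_t a b \<gamma> (\<lambda>p. f p + e * g p) p = caputo_t a b \<gamma> f p + e * caputo_t a b \<gamma> g p"
proof -
  obtain t x where p: "p = (t, x)" and tx: "t \<in> {a..b}" "x \<in> cbox aa bb"
    using assms(3) by (auto simp: Pset_def)
  obtain f' where f': "\<And>s. s \<in> {a..b} \<Longrightarrow>
      ((\<lambda>s. f (s, x)) has_real_derivative f' s) (at s within {a..b})" "continuous_on {a..b} f'"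
    by (rule C1_on_t_slice[OF assms(4) tx(2)]) blast
  obtain g' where g': "\<And>s. s \<in> {a..b} \<Longrightarrow>
      ((\<lambda>s. g (s, x)) has_real_derivative g' s) (at s within {a..b})" "continuous_on {a..b} g'"
    by (rule C1_on_t_slice[OF assms(5) tx(2)]) blast
  show ?thesis
    unfolding caputo_t_def p fst_conv snd_conv
    by (rule caputo_left_add_cmult[OF assms(1,2) tx(1) f' g'])
qed

lemma caputo_x_add_cmult:
  assumes "\<gamma> < 1" "aa $ i < bb $ i" "p \<in> Pset a b aa bb"
    "C1_on (Pset a b aa bb) f" "C1_on (Pset a b aa bb) g"
  shows "caputo_x aa bb i \<gamma> (\<lambda>p. f p + e * g p) p = caputo_x aa bb i \<gamma> f p + e * caputo_x aa bb i \<gamma> g p"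
proof -
  obtain t x where p: "p = (t, x)" and tx: "t \<in> {a..b}" "x \<in> cbox aa bb"
    using assms(3) by (auto simp: Pset_def)
  have xi: "x $ i \<in> {aa $ i..bb $ i}" using tx by (auto simp: mem_box_cart)
  obtain f' where f': "\<And>s. s \<in> {aa $ i..bb $ i} \<Longrightarrow>
      ((\<lambda>s. f (t, xupd x i s)) has_real_derivative f' s) (at s within {aa $ i..bb $ i})"
    "continuous_on {aa $ i..bb $ i} f'"
    by (rule C1_on_x_slice[OF assms(4) tx, where i=i]) blast
  obtain g' where g': "\<And>s. s \<in> {aa $ i..bb $ i} \<Longrightarrow>
      ((\<lambda>s. g (t, xupd x i s)) has_real_derivative g' s) (at s within {aa $ i..bb $ i})"
    "continuous_on {aa $ i..bb $ i} g'"
    by (rule C1_on_x_slice[OF assms(5) tx, where i=i]) blast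
  show ?thesis
    unfolding caputo_x_def p fst_conv snd_conv
    by (rule caputo_left_add_cmult[OF assms(1,2) xi f' g'])
qed

text \<open>Makes the equation for \<open>Z\<close> available at every perturbed function: the
  boundary values stay \<open>g\<close> because \<open>h\<close> vanishes on the frontier.\<close>

lemma admissible_add_scaleR:
  assumes ab: "a < b" and abi: "\<forall>i. aa $ i < bb $ i"
    and alpha: "\<forall>j. \<alpha> $ j < 1" and beta: "\<forall>i j. \<beta> $ i $ j < 1"
    and u: "admissible a b aa bb \<alpha> \<beta> g u" and h: "admissible a b aa bb \<alpha> \<beta> (\<lambda>_. 0) h"
  shows "admissible a b aa bb \<alpha> \<beta> g (\<lambda>p. u p + e *\<^sub>R h p)"
proof -
  let ?P = "Pset a b aa bb"
  have C: "C1_on ?P (\<lambda>p. u p $ j)" "C1_on ?P (\<lambda>p. h p $ j)"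
    "C1_on ?P (caputo_t a b (\<alpha> $ j) (\<lambda>p. u p $ j))" "C1_on ?P (caputo_t a b (\<alpha> $ j) (\<lambda>p. h p $ j))"
    "C1_on ?P (caputo_x aa bb i (\<beta> $ i $ j) (\<lambda>p. u p $ j))"
    "C1_on ?P (caputo_x aa bb i (\<beta> $ i $ j) (\<lambda>p. h p $ j))" for i j
    using u h by (auto simp: admissible_def)
  have 1: "C1_on ?P (\<lambda>p. u p $ j + e * h p $ j)" for j
    by (intro C1_on_add C1_on_mult C1_on_const C)
  have 2: "C1_on ?P (caputo_t a b (\<alpha> $ j) (\<lambda>p. u p $ j + e * h p $ j))" for j
    by (rule C1_on_cong[OF C1_on_add[OF C(3) C1_on_mult[OF C1_on_const C(4)]]])
       (rule caputo_t_add_cmult[OF alpha[rule_format] ab _ C(1,2), symmetric])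
  have 3: "C1_on ?P (caputo_x aa bb i (\<beta> $ i $ j) (\<lambda>p. u p $ j + e * h p $ j))" for i j
    by (rule C1_on_cong[OF C1_on_add[OF C(5) C1_on_mult[OF C1_on_const C(6)]]])
       (rule caputo_x_add_cmult[OF beta[rule_format] abi[rule_format] _ C(1,2), symmetric])
  show ?thesis
    using 1 2 3 u h by (simp add: admissible_def)
qed

text \<open>Along the segment the arguments of \<open>L\<close> move on a straight line. The point
  \<open>(t, x)\<close> is not varied, hence the component 0; the slot of z is kept apart because z
  need not be affine in \<open>e\<close>.\<close>

lemma largs_add_scaleR:
  assumes ab: "a < b" and abi: "\<forall>i. aa $ i < bb $ i"
    and alpha: "\<forall>j. \<alpha> $ j < 1" and beta: "\<forall>i j. \<beta> $ i $ j < 1"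
    and u: "admissible a b aa bb \<alpha> \<beta> g u" and h: "admissible a b aa bb \<alpha> \<beta> (\<lambda>_. 0) h"
    and tx: "t \<in> {a..b}" "x \<in> cbox aa bb"
  shows "largs a b aa bb \<alpha> \<beta> (\<lambda>p. u p + e *\<^sub>R h p) y t x =
    largs a b aa bb \<alpha> \<beta> u 0 t x + e *\<^sub>R (0, snd (largs a b aa bb \<alpha> \<beta> h 0 t x)) + (0, 0, 0, 0, y)"
proof -
  let ?P = "Pset a b aa bb"
  have C: "C1_on ?P (\<lambda>p. u p $ j)" "C1_on ?P (\<lambda>p. h p $ j)" for j
    using u h by (auto simp: admissible_def)
  have P: "(t, x) \<in> ?P" using tx by (simp add: mem_Pset)
  have "caputo_t a b (\<alpha> $ j) (\<lambda>p. u p $ j + e * h p $ j) (t, x) =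
      caputo_t a b (\<alpha> $ j) (\<lambda>p. u p $ j) (t, x) + e * caputo_t a b (\<alpha> $ j) (\<lambda>p. h p $ j) (t, x)"
    "caputo_x aa bb i (\<beta> $ i $ j) (\<lambda>p. u p $ j + e * h p $ j) (t, x) =
      caputo_x aa bb i (\<beta> $ i $ j) (\<lambda>p. u p $ j) (t, x) + e * caputo_x aa bb i (\<beta> $ i $ j) (\<lambda>p. h p $ j) (t, x)"
    for i j
    by (rule caputo_t_add_cmult[OF alpha[rule_format] ab P C])
       (rule caputo_x_add_cmult[OF beta[rule_format] abi[rule_format] P C])
  then show ?thesis
    by (simp add: largs_def vec_eq_iff)
qed

lemma continuous_on_largs:
  fixes u :: "real \<times> (real^'n) \<Rightarrow> real^'m"
  assumes "admissible a b aa bb \<alpha> \<beta> g u"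
  shows "continuous_on (Pset a b aa bb) (\<lambda>p. largs a b aa bb \<alpha> \<beta> u y (fst p) (snd p))"
proof -
  let ?P = "Pset a b aa bb"
  have C: "continuous_on ?P (\<lambda>p. u p $ j)"
    "continuous_on ?P (caputo_t a b (\<alpha> $ j) (\<lambda>p. u p $ j))"
    "continuous_on ?P (caputo_x aa bb i (\<beta> $ i $ j) (\<lambda>p. u p $ j))" for i j
    using assms by (auto simp: admissible_def intro: C1_on_imp_continuous_on)
  have "continuous_on ?P (\<lambda>p. \<chi> j. u p $ j)"
    by (intro continuous_on_vec_lambda C)
  then have "continuous_on ?P u" by simp
  then show ?thesis
    unfolding largs_def prod.collapse by (intro continuous_intros continuous_on_vec_lambda C)
qed

section \<open>Fractional integration by parts over the box\<close>

lemma integral_Pset: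
  fixes f :: "real \<times> (real^'n) \<Rightarrow> real"
  assumes "continuous_on (Pset a b aa bb) f"
  shows "integral (Pset a b aa bb) f = integral {a..b} (\<lambda>t. integral (cbox aa bb) (\<lambda>x. f (t, x)))"
    and "integral (Pset a b aa bb) f = integral (cbox aa bb) (\<lambda>x. integral {a..b} (\<lambda>t. f (t, x)))"
  using integral_prod_continuous[of a aa b bb f] integral_swap_continuous[of a aa b bb "\<lambda>t x. f (t, x)"] assms
  by (simp_all add: Pset_eq_cbox)

lemma continuous_on_Pset_t_slice:
  assumes "continuous_on (Pset a b aa bb) f" "x \<in> cbox aa bb"
  shows "continuous_on {a..b} (\<lambda>s. f (s, x))"
  by (rule continuous_on_compose2[OF assms(1)]) (use assms(2) in \<open>auto intro!: continuous_intros simp: mem_Pset\<close>)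

lemma continuous_on_Pset_x_slice:
  assumes "continuous_on (Pset a b aa bb) f" "t \<in> {a..b}" "x \<in> cbox aa bb"
  shows "continuous_on {aa $ i..bb $ i} (\<lambda>s. f (t, xupd x i s))"
  by (rule continuous_on_compose2[OF assms(1)])
     (use assms(2) xupd_in_cbox[OF assms(3)] in \<open>auto intro!: continuous_intros simp: mem_Pset\<close>)

text \<open>Time can be made the inner variable directly, and for every \<open>x\<close> in the box
  both \<open>(a, x)\<close> and \<open>(b, x)\<close> are frontier points, so the one-dimensional
  formula applies on each line.\<close>

lemma integral_by_parts_caputo_t:
  assumes \<gamma>: "\<gamma> < 1" and ab: "a < b"
    and F: "continuous_on (Pset a b aa bb) F"
    and ex: "\<forall>p\<in>Pset a b aa bb. RL_t_exists a b \<gamma> F p"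
    and RL: "continuous_on (Pset a b aa bb) (RL_t a b \<gamma> F)"
    and B: "C1_on (Pset a b aa bb) B" and DB: "continuous_on (Pset a b aa bb) (caputo_t a b \<gamma> B)"
    and B0: "\<forall>p\<in>frontier (Pset a b aa bb). B p = 0"
  shows "integral (Pset a b aa bb) (\<lambda>p. F p * caputo_t a b \<gamma> B p) =
         integral (Pset a b aa bb) (\<lambda>p. RL_t a b \<gamma> F p * B p)"
proof -
  let ?P = "Pset a b aa bb"
  have c: "continuous_on ?P (\<lambda>p. F p * caputo_t a b \<gamma> B p)" "continuous_on ?P (\<lambda>p. RL_t a b \<gamma> F p * B p)"
    by (intro continuous_intros F DB RL C1_on_imp_continuous_on[OF B])+
  have "integral {a..b} (\<lambda>t. F (t, x) * caputo_t a b \<gamma> B (t, x)) =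
      integral {a..b} (\<lambda>t. RL_t a b \<gamma> F (t, x) * B (t, x))" if x: "x \<in> cbox aa bb" for x
  proof -
    obtain B' where B': "\<And>s. s \<in> {a..b} \<Longrightarrow> ((\<lambda>s. B (s, x)) has_real_derivative B' s) (at s within {a..b})"
      "continuous_on {a..b} B'"
      by (rule C1_on_t_slice[OF B x]) blast
    have "(a, x) \<in> frontier ?P" "(b, x) \<in> frontier ?P"
      using x ab by (auto simp: frontier_Pset mem_Pset)
    then have "B (a, x) = 0" "B (b, x) = 0" using B0 by auto
    moreover have "RL_right_exists a b \<gamma> (\<lambda>s. F (s, x)) s" if "s \<in> {a..b}" for s
    proof -
      have "(s, x) \<in> ?P" using that x by (simp add: mem_Pset)
      with ex have "RL_t_exists a b \<gamma> F (s, x)" by blast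
      then show ?thesis by (simp add: RL_t_exists_def)
    qed
    moreover have "continuous_on {a..b} (RL_right a b \<gamma> (\<lambda>s. F (s, x)))"
      using continuous_on_Pset_t_slice[OF RL x] by (simp add: RL_t_def)
    ultimately show ?thesis
      unfolding caputo_t_def RL_t_def fst_conv snd_conv
      by (intro fractional_integration_by_parts[OF \<gamma> ab continuous_on_Pset_t_slice[OF F x] B'])
  qed
  then show ?thesis
    unfolding integral_Pset(2)[OF c(1)] integral_Pset(2)[OF c(2)] by (rule integral_cong)
qed

text \<open>The coordinate \<open>i\<close> is not a factor of a pair, so the inner integral over it
  is produced by \<open>integral_cbox_slice\<close>; the side length this introduces is positive and
  cancels.\<close>

lemma integral_by_parts_caputo_x:
  assumes \<gamma>: "\<gamma> < 1" and abi: "aa $ i < bb $ i"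
    and F: "continuous_on (Pset a b aa bb) F"
    and ex: "\<forall>p\<in>Pset a b aa bb. RL_x_exists aa bb i \<gamma> F p"
    and RL: "continuous_on (Pset a b aa bb) (RL_x aa bb i \<gamma> F)"
    and B: "C1_on (Pset a b aa bb) B" and DB: "continuous_on (Pset a b aa bb) (caputo_x aa bb i \<gamma> B)"
    and B0: "\<forall>p\<in>frontier (Pset a b aa bb). B p = 0"
  shows "integral (Pset a b aa bb) (\<lambda>p. F p * caputo_x aa bb i \<gamma> B p) =
         integral (Pset a b aa bb) (\<lambda>p. RL_x aa bb i \<gamma> F p * B p)"
proof -
  let ?P = "Pset a b aa bb"
  have c: "continuous_on ?P (\<lambda>p. F p * caputo_x aa bb i \<gamma> B p)" "continuous_on ?P (\<lambda>p. RL_x aa bb i \<gamma> F p * B p)"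
    by (intro continuous_intros F DB RL C1_on_imp_continuous_on[OF B])+
  have sl: "integral {aa $ i..bb $ i} (\<lambda>s. F (t, xupd x i s) * caputo_x aa bb i \<gamma> B (t, xupd x i s)) =
      integral {aa $ i..bb $ i} (\<lambda>s. RL_x aa bb i \<gamma> F (t, xupd x i s) * B (t, xupd x i s))"
    if t: "t \<in> {a..b}" and x: "x \<in> cbox aa bb" for t x
  proof -
    \<comment> \<open>At a point of a slice, \<open>caputo_x\<close> and \<open>RL_x\<close> update
      the same coordinate once more; the second update overrides the first, so all points of a slice
      see the same one-variable function.\<close>
    have xx: "xupd (xupd x i s) i r = xupd x i r" for s r by (simp add: vec_eq_iff)
    obtain B' where B': "\<And>s. s \<in> {aa $ i..bb $ i} \<Longrightarrow>
        ((\<lambda>s. B (t, xupd x i s)) has_real_derivative B' s) (at s within {aa $ i..bb $ i})"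
      "continuous_on {aa $ i..bb $ i} B'"
      by (rule C1_on_x_slice[OF B t x, where i=i]) blast
    have "(t, xupd x i (aa $ i)) \<in> frontier ?P" "(t, xupd x i (bb $ i)) \<in> frontier ?P"
      using t xupd_in_cbox[OF x] abi by (auto simp: frontier_Pset mem_Pset mem_box_cart)
    then have "B (t, xupd x i (aa $ i)) = 0" "B (t, xupd x i (bb $ i)) = 0" using B0 by auto
    moreover have "RL_right_exists (aa $ i) (bb $ i) \<gamma> (\<lambda>s. F (t, xupd x i s)) s" if "s \<in> {aa $ i..bb $ i}" for s
    proof -
      have "(t, xupd x i s) \<in> ?P" using t xupd_in_cbox[OF x that] by (simp add: mem_Pset)
      with ex have "RL_x_exists aa bb i \<gamma> F (t, xupd x i s)" by blast
      then show ?thesis by (simp add: RL_x_exists_def xx)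
    qed
    moreover have "continuous_on {aa $ i..bb $ i} (RL_right (aa $ i) (bb $ i) \<gamma> (\<lambda>s. F (t, xupd x i s)))"
      using continuous_on_Pset_x_slice[OF RL t x, of i] by (simp add: RL_x_def xx)
    ultimately have "integral {aa $ i..bb $ i} (\<lambda>s. F (t, xupd x i s) *
          caputo_left (aa $ i) (bb $ i) \<gamma> (\<lambda>s. B (t, xupd x i s)) s) =
        integral {aa $ i..bb $ i} (\<lambda>s. RL_right (aa $ i) (bb $ i) \<gamma> (\<lambda>s. F (t, xupd x i s)) s * B (t, xupd x i s))"
      by (intro fractional_integration_by_parts[OF \<gamma> abi continuous_on_Pset_x_slice[OF F t x] B'])
    then show ?thesis by (simp add: caputo_x_def RL_x_def xx)
  qed
  have "integral (cbox aa bb) (\<lambda>x. F (t, x) * caputo_x aa bb i \<gamma> B (t, x)) =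
      integral (cbox aa bb) (\<lambda>x. RL_x aa bb i \<gamma> F (t, x) * B (t, x))" if t: "t \<in> {a..b}" for t
  proof -
    have c': "continuous_on (cbox aa bb) (\<lambda>x. k (t, x))" if "continuous_on ?P k" for k :: "_ \<Rightarrow> real"
      by (rule continuous_on_compose2[OF that]) (use t in \<open>auto intro!: continuous_intros simp: mem_Pset\<close>)
    have "(bb $ i - aa $ i) * integral (cbox aa bb) (\<lambda>x. F (t, x) * caputo_x aa bb i \<gamma> B (t, x)) =
        (bb $ i - aa $ i) * integral (cbox aa bb) (\<lambda>x. RL_x aa bb i \<gamma> F (t, x) * B (t, x))"
      unfolding integral_cbox_slice[OF c'[OF c(1)] less_imp_le[OF abi]]
        integral_cbox_slice[OF c'[OF c(2)] less_imp_le[OF abi]]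
      by (rule integral_cong) (rule sl[OF t])
    then show ?thesis using abi by simp
  qed
  then show ?thesis
    unfolding integral_Pset(1)[OF c(1)] integral_Pset(1)[OF c(2)] by (rule integral_cong)
qed

section \<open>Test variations\<close>

text \<open>Each variable has a factor of its own, so a partial Caputo derivative acts on one factor
  and the others come out as constants.\<close>

definition box_bump :: "real \<times> (real^'n) \<Rightarrow> real \<times> (real^'n) \<Rightarrow> real \<times> (real^'n) \<Rightarrow> real" where
  "box_bump p q y = bump (fst p) (fst q) (fst y) * (\<Prod>k\<in>UNIV. bump (snd p $ k) (snd q $ k) (snd y $ k))"

lemma C1_on_bump_compose:
  "bounded_linear l \<Longrightarrow> C1_on S (\<lambda>y. bump p q (l y))"
  using bump_C1[of p q] C1_on_compose_bounded_linear[of "bump p q"] by blast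

lemma bounded_linear_snd_nth: "bounded_linear (\<lambda>y::real \<times> (real^'n). snd y $ k)"
  by (rule bounded_linear_compose[OF bounded_linear_vec_nth bounded_linear_snd])

lemma C1_on_box_bump: "C1_on S (box_bump p q)"
  unfolding box_bump_def[abs_def]
  by (intro C1_on_mult C1_on_prod C1_on_bump_compose bounded_linear_fst bounded_linear_snd_nth)

lemma box_bump_nonneg: "0 \<le> box_bump p q y"
  by (simp add: box_bump_def bump_nonneg prod_nonneg)

lemma box_bump_pos:
  assumes "fst y \<in> {fst p<..<fst q}" "snd y \<in> box (snd p) (snd q)"
  shows "0 < box_bump p q y"
  using assms by (auto simp: box_bump_def mem_box_cart intro!: mult_pos_pos prod_pos bump_pos)

lemma box_bump_eq_0:
  assumes "fst p < fst q" "\<And>k. snd p $ k < snd q $ k"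
    and "\<not> (fst y \<in> {fst p<..<fst q} \<and> snd y \<in> box (snd p) (snd q))"
  shows "box_bump p q y = 0"
proof (cases "fst y \<in> {fst p<..<fst q}")
  case True
  with assms(3) obtain k where "\<not> (snd p $ k < snd y $ k \<and> snd y $ k < snd q $ k)"
    by (auto simp: mem_box_cart)
  then have "bump (snd p $ k) (snd q $ k) (snd y $ k) = 0"
    using assms(2) by (intro bump_eq_0) auto
  then show ?thesis by (auto simp: box_bump_def intro!: prod_zero)
next
  case False
  then show ?thesis using bump_eq_0[OF assms(1)] by (simp add: box_bump_def)
qed

lemma C1_on_caputo_t_box_bump:
  assumes \<gamma>: "\<gamma> < 1" and ab: "a < b" and p: "a \<le> fst p" "fst p < fst q"
  shows "C1_on (Pset a b aa bb) (caputo_t a b \<gamma> (box_bump p q))"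
proof -
  obtain D D' where D: "\<And>s. (D has_real_derivative D' s) (at s)" "continuous_on UNIV D'"
    "\<And>s. s \<in> {a..b} \<Longrightarrow> caputo_left a b \<gamma> (bump (fst p) (fst q)) s = D s"
    by (rule caputo_left_bump[OF \<gamma> ab p]) blast
  obtain \<phi>' where \<phi>': "\<And>s. (bump (fst p) (fst q) has_real_derivative \<phi>' s) (at s)" "continuous_on UNIV \<phi>'"
    using bump_C1 by blast
  let ?C = "\<lambda>y. \<Prod>k\<in>UNIV. bump (snd p $ k) (snd q $ k) (snd y $ k)"
  have "C1_on (Pset a b aa bb) (\<lambda>y. ?C y * D (fst y))"
    by (intro C1_on_mult C1_on_prod C1_on_bump_compose bounded_linear_fst bounded_linear_snd_nth
        C1_on_compose_bounded_linear[OF D(1,2)])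
  then show ?thesis
  proof (rule C1_on_cong)
    fix y assume "y \<in> Pset a b aa bb"
    then have y: "fst y \<in> {a..b}" by (auto simp: Pset_def)
    have "caputo_t a b \<gamma> (box_bump p q) y = caputo_left a b \<gamma> (\<lambda>s. ?C y * bump (fst p) (fst q) s) (fst y)"
      by (simp add: caputo_t_def box_bump_def mult.commute)
    also have "\<dots> = ?C y * D (fst y)"
      using caputo_left_cmult[OF \<gamma> ab y has_field_derivative_at_within[OF \<phi>'(1)]
          continuous_on_subset[OF \<phi>'(2) subset_UNIV]] D(3)[OF y] by simp
    finally show "?C y * D (fst y) = caputo_t a b \<gamma> (box_bump p q) y" ..
  qed
qed

lemma C1_on_caputo_x_box_bump:
  assumes \<gamma>: "\<gamma> < 1" and ab: "aa $ i < bb $ i" and p: "aa $ i \<le> snd p $ i" "snd p $ i < snd q $ i"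
  shows "C1_on (Pset a b aa bb) (caputo_x aa bb i \<gamma> (box_bump p q))"
proof -
  let ?b = "bump (snd p $ i) (snd q $ i)"
  obtain D D' where D: "\<And>s. (D has_real_derivative D' s) (at s)" "continuous_on UNIV D'"
    "\<And>s. s \<in> {aa $ i..bb $ i} \<Longrightarrow> caputo_left (aa $ i) (bb $ i) \<gamma> ?b s = D s"
    by (rule caputo_left_bump[OF \<gamma> ab p]) blast
  obtain \<phi>' where \<phi>': "\<And>s. (?b has_real_derivative \<phi>' s) (at s)" "continuous_on UNIV \<phi>'"
    using bump_C1 by blast
  let ?C = "\<lambda>y. bump (fst p) (fst q) (fst y) * (\<Prod>k\<in>UNIV - {i}. bump (snd p $ k) (snd q $ k) (snd y $ k))"
  have "C1_on (Pset a b aa bb) (\<lambda>y. ?C y * D (snd y $ i))"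
    by (intro C1_on_mult C1_on_prod C1_on_bump_compose bounded_linear_fst bounded_linear_snd_nth
        C1_on_compose_bounded_linear[OF D(1,2)])
  then show ?thesis
  proof (rule C1_on_cong)
    fix y assume "y \<in> Pset a b aa bb"
    then have y: "snd y $ i \<in> {aa $ i..bb $ i}" by (auto simp: Pset_def mem_box_cart)
    have "box_bump p q (fst y, xupd (snd y) i s) = ?C y * ?b s" for s
      by (simp add: box_bump_def prod.remove[of UNIV i] mult_ac)
    then have "caputo_x aa bb i \<gamma> (box_bump p q) y = caputo_left (aa $ i) (bb $ i) \<gamma> (\<lambda>s. ?C y * ?b s) (snd y $ i)"
      by (simp add: caputo_x_def)
    also have "\<dots> = ?C y * D (snd y $ i)"
      using caputo_left_cmult[OF \<gamma> ab y has_field_derivative_at_within[OF \<phi>'(1)]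
          continuous_on_subset[OF \<phi>'(2) subset_UNIV]] D(3)[OF y] by simp
    finally show "?C y * D (snd y $ i) = caputo_x aa bb i \<gamma> (box_bump p q) y" ..
  qed
qed

section \<open>Variations of a single component\<close>

lemma caputo_t_zero: "a < b \<Longrightarrow> p \<in> Pset a b aa bb \<Longrightarrow> caputo_t a b \<gamma> (\<lambda>_. 0) p = 0"
  by (auto simp: caputo_t_def Pset_def intro!: caputo_left_zero)

lemma caputo_x_zero:
  "aa $ i < bb $ i \<Longrightarrow> p \<in> Pset a b aa bb \<Longrightarrow> caputo_x aa bb i \<gamma> (\<lambda>_. 0) p = 0"
  by (auto simp: caputo_x_def Pset_def mem_box_cart intro!: caputo_left_zero)

lemma admissible_axis:
  assumes ab: "a < b" and abi: "\<forall>i. aa $ i < bb $ i"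
    and B: "C1_on (Pset a b aa bb) B"
    and Bt: "C1_on (Pset a b aa bb) (caputo_t a b (\<alpha> $ j) B)"
    and Bx: "\<And>i. C1_on (Pset a b aa bb) (caputo_x aa bb i (\<beta> $ i $ j) B)"
    and B0: "\<forall>p\<in>frontier (Pset a b aa bb). B p = 0"
  shows "admissible a b aa bb \<alpha> \<beta> (\<lambda>_. 0) (\<lambda>p. axis j (B p))"
proof -
  let ?P = "Pset a b aa bb"
  have "C1_on ?P (\<lambda>p. axis j (B p) $ j') \<and> C1_on ?P (caputo_t a b (\<alpha> $ j') (\<lambda>p. axis j (B p) $ j'))
     \<and> (\<forall>i. C1_on ?P (caputo_x aa bb i (\<beta> $ i $ j') (\<lambda>p. axis j (B p) $ j')))" for j'
  proof (cases "j' = j")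
    case True
    with B Bt Bx show ?thesis by (simp add: axis_def)
  next
    case False
    have "C1_on ?P (caputo_t a b \<gamma> (\<lambda>_. 0))" for \<gamma>
      by (rule C1_on_cong[OF C1_on_const[of _ 0]]) (simp only: caputo_t_zero[OF ab])
    moreover have "C1_on ?P (caputo_x aa bb i \<gamma> (\<lambda>_. 0))" for i \<gamma>
      by (rule C1_on_cong[OF C1_on_const[of _ 0]]) (simp only: caputo_x_zero[OF abi[rule_format]])
    ultimately show ?thesis using False by (simp add: axis_def C1_on_const)
  qed
  moreover have "axis j (0::real) = 0" by (simp add: vec_eq_iff axis_def)
  ultimately show ?thesis using B0 by (simp add: admissible_def)
qed

text \<open>Expands the direction of variation along the coordinate directions that define the
  partial derivatives of \<open>L\<close>; a linear derivative applied to it then becomes a sum of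
  partial derivatives.\<close>

lemma largs_axis:
  fixes B :: "real \<times> (real^'n) \<Rightarrow> real" and \<alpha> :: "real^'m" and \<beta> :: "real^'m^'n"
  assumes ab: "a < b" and abi: "\<forall>i. aa $ i < bb $ i" and P: "(t, x) \<in> Pset a b aa bb"
  shows "((0, snd (largs a b aa bb \<alpha> \<beta> (\<lambda>p. axis j (B p)) 0 t x)) :: ('n, 'm) larg) =
    B (t, x) *\<^sub>R dir_u j + caputo_t a b (\<alpha> $ j) B (t, x) *\<^sub>R dir_Dt j
      + (\<Sum>i\<in>UNIV. caputo_x aa bb i (\<beta> $ i $ j) B (t, x) *\<^sub>R dir_Dx i j)"
proof -
  have t: "caputo_t a b (\<alpha> $ j') (\<lambda>p. axis j (B p) $ j') (t, x) =
      (if j' = j then caputo_t a b (\<alpha> $ j) B (t, x) else 0)" for j'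
    using caputo_t_zero[OF ab P] by (simp add: axis_def)
  have x: "caputo_x aa bb i (\<beta> $ i $ j') (\<lambda>p. axis j (B p) $ j') (t, x) =
      (if j' = j then caputo_x aa bb i (\<beta> $ i $ j) B (t, x) else 0)" for i j'
    using caputo_x_zero[OF abi[rule_format] P] by (simp add: axis_def)
  have s: "(\<Sum>i\<in>UNIV. c i *\<^sub>R (dir_Dx i j :: ('n, 'm) larg)) = (0, 0, 0, (\<chi> i. \<chi> j'. if j' = j then c i else 0), 0)"
    for c :: "'n \<Rightarrow> real"
  proof -
    have "(\<Sum>i\<in>UNIV. c i *\<^sub>R (dir_Dx i j :: ('n, 'm) larg)) =
      (0, 0, 0, (\<Sum>i\<in>UNIV. c i *\<^sub>R axis i (axis j 1)), 0)"
      by (simp add: dir_Dx_def prod_eq_iff fst_sum snd_sum)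
    also have "(\<Sum>i\<in>UNIV. c i *\<^sub>R axis i (axis j (1::real))) = (\<chi> i. \<chi> j'. if j' = j then c i else 0)"
      by (auto simp: vec_eq_iff sum_component axis_def if_distrib if_distribR sum.If_cases cong: if_cong)
    finally show ?thesis .
  qed
  show ?thesis
    unfolding s largs_def t x by (simp add: dir_u_def dir_Dt_def vec_eq_iff axis_def)
qed

text \<open>\<open>L\<close> is differentiable only within \<open>S \<times> UNIV\<close>, while
  \<open>pderivL\<close> is a two-sided derivative along a line. A direction with vanishing first
  component never leaves that set, so the two agree even where \<open>fst q\<close> is on the
  boundary of \<open>S\<close>.\<close>

lemma pderivL_eq:
  fixes L :: "('n::finite, 'm::finite) larg \<Rightarrow> real"
  assumes L: "(L has_derivative L') (at q within S \<times> UNIV)" and q: "fst q \<in> S" and v: "fst v = 0"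
  shows "pderivL L q v = L' v"
proof -
  have "((\<lambda>s. L (q + s *\<^sub>R v)) has_derivative (\<lambda>h. L' (h *\<^sub>R v))) (at 0 within UNIV)"
  proof (rule has_derivative_in_compose[where g=L])
    show "((\<lambda>s. q + s *\<^sub>R v) has_derivative (\<lambda>h. h *\<^sub>R v)) (at 0 within UNIV)"
      by (auto intro!: derivative_eq_intros)
    have "range (\<lambda>s. q + s *\<^sub>R v) \<subseteq> S \<times> UNIV"
    proof
      fix y assume "y \<in> range (\<lambda>s. q + s *\<^sub>R v)"
      then obtain s where "y = q + s *\<^sub>R v" by blast
      with q v have "fst y \<in> S" by simp
      then show "y \<in> S \<times> UNIV" by (simp only: mem_Times_iff UNIV_I simp_thms)
    qed
    then show "(L has_derivative L') (at (q + 0 *\<^sub>R v) within range (\<lambda>s. q + s *\<^sub>R v))"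
      using has_derivative_subset[OF L] by simp
  qed
  moreover have "L' (h *\<^sub>R v) = h * L' v" for h
    using has_derivative_linear[OF L] by (simp add: linear_cmul)
  ultimately have "((\<lambda>s. L (q + s *\<^sub>R v)) has_real_derivative L' v) (at 0)"
    by (simp add: has_field_derivative_def mult.commute[of _ "L' v"])
  then show ?thesis unfolding pderivL_def by (rule DERIV_imp_deriv)
qed

section \<open>Fundamental lemma of the calculus of variations\<close>

lemma box_Pair_eq: "box (a, c) (b, d) = box a b \<times> box c d"
  by (force simp: box_def Basis_prod_def)

lemma fundamental_lemma_box_bump:
  fixes E :: "real \<times> (real^'n) \<Rightarrow> real"
  assumes ab: "a < b" and abi: "\<forall>i. aa $ i < bb $ i"
    and E: "continuous_on (Pset a b aa bb) E"
    and zero: "\<And>p q. a \<le> fst p \<Longrightarrow> fst p < fst q \<Longrightarrow> fst q \<le> b \<Longrightarrow>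
      (\<And>k. aa $ k \<le> snd p $ k \<and> snd p $ k < snd q $ k \<and> snd q $ k \<le> bb $ k) \<Longrightarrow>
      integral (Pset a b aa bb) (\<lambda>y. E y * box_bump p q y) = 0"
    and y: "y \<in> Pset a b aa bb"
  shows "E y = 0"
proof -
  let ?I = "box (a, aa) (b, bb)"
  have ne: "?I \<noteq> {}"
    using ab abi by (auto simp: box_Pair_eq interval_eq_empty_cart not_le)
  have sub: "?I \<subseteq> Pset a b aa bb" unfolding Pset_eq_cbox by (rule box_subset_cbox)
  have I0: "E y0 = 0" if y0: "y0 \<in> ?I" for y0
  proof (rule ccontr)
    assume "E y0 \<noteq> 0"
    define f where "f = (\<lambda>y. sgn (E y0) * E y)"
    have f0: "f y0 > 0" using \<open>E y0 \<noteq> 0\<close> by (simp add: f_def sgn_if)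
    have cf: "continuous_on (Pset a b aa bb) f" unfolding f_def by (intro continuous_intros E)
    have "open (?I \<inter> f -` {0<..})"
      by (intro continuous_open_preimage continuous_on_subset[OF cf sub] open_box open_greaterThan)
    \<comment> \<open>On this closed box \<open>f\<close> is positive, and outside its interior the
      bump vanishes; their product is thus nonnegative throughout, and a zero integral forces it to
      be 0 at \<open>y0\<close>.\<close>
    then obtain p q where pq: "cbox p q \<subseteq> ?I \<inter> f -` {0<..}" "y0 \<in> box p q"
      by (rule open_contains_cbox[where x=y0]) (use y0 f0 in auto)
    have y0': "fst y0 \<in> {fst p<..<fst q}" "snd y0 \<in> box (snd p) (snd q)"
      using pq(2) by (cases p; cases q; cases y0; auto simp: box_Pair_eq)+
    have lt: "fst p < fst q" "\<And>k. snd p $ k < snd q $ k"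
      using y0' by (auto simp: mem_box_cart intro: less_trans)
    have "p \<in> cbox p q" "q \<in> cbox p q"
      using lt by (cases p; cases q; auto simp: cbox_Pair_eq mem_box_cart less_imp_le)+
    then have "p \<in> Pset a b aa bb" "q \<in> Pset a b aa bb" using pq(1) sub by auto
    then have "integral (Pset a b aa bb) (\<lambda>y. E y * box_bump p q y) = 0"
      using lt by (intro zero) (auto simp: Pset_def mem_box_cart)
    then have i0: "integral (Pset a b aa bb) (\<lambda>y. f y * box_bump p q y) = 0"
      by (simp add: f_def mult.assoc)
    have c: "continuous_on (Pset a b aa bb) (\<lambda>y. f y * box_bump p q y)"
      by (intro continuous_intros cf C1_on_imp_continuous_on[OF C1_on_box_bump])
    have "f y0 * box_bump p q y0 = 0"
    proof (rule has_integral_0_cbox_imp_0[OF c[unfolded Pset_eq_cbox]])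
      show "((\<lambda>y. f y * box_bump p q y) has_integral 0) (cbox (a, aa) (b, bb))"
        using i0 integrable_continuous[OF c[unfolded Pset_eq_cbox]]
        by (simp add: Pset_eq_cbox has_integral_iff)
      show "0 \<le> f x * box_bump p q x" for x
      proof (cases "fst x \<in> {fst p<..<fst q} \<and> snd x \<in> box (snd p) (snd q)")
        case True
        then have "x \<in> box p q" by (cases p; cases q; cases x; auto simp: box_Pair_eq)
        then have "f x > 0" using pq(1) box_subset_cbox[of p q] by auto
        then show ?thesis by (simp add: box_bump_nonneg)
      next
        case False
        then show ?thesis using box_bump_eq_0[of p q x] lt by simp
      qed
      show "?I \<noteq> {}" by fact
      show "y0 \<in> cbox (a, aa) (b, bb)" using y0 box_subset_cbox by blast
    qed
    with f0 box_bump_pos[OF y0'] show False by simp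
  qed
  \<comment> \<open>The boundary is reached by continuity of \<open>E\<close>, the open box being
    dense.\<close>
  have "closure ?I = Pset a b aa bb" unfolding Pset_eq_cbox by (rule closure_box[OF ne])
  with continuous_constant_on_closure[of ?I E 0 y] E I0 y show ?thesis by simp
qed

section \<open>The first variation\<close>

text \<open>\<open>W e\<close> solves the equation with parameter \<open>e\<close>, and
  \<open>lin\<close> splits the parameter derivative of the integrand into a forcing term
  \<open>A\<close> and the feedback \<open>M * \<zeta>\<close> through the solution. The integrating
  factor absorbs the feedback.\<close>

lemma linearized_ode_integral_zero:
  fixes W :: "real \<Rightarrow> real \<Rightarrow> real" and G G' :: "real \<Rightarrow> real \<Rightarrow> 'a::euclidean_space \<Rightarrow> real"
  assumes ab: "a < b"
    and init: "\<And>e. W e a = za"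
    and ode: "\<And>e t. t \<in> {a..b} \<Longrightarrow>
      (W e has_real_derivative integral (cbox c d) (G e t)) (at t within {a..b})"
    and G: "continuous_on ((UNIV \<times> {a..b}) \<times> cbox c d) (\<lambda>((e, t), x). G e t x)"
    and G': "\<And>e t x. t \<in> {a..b} \<Longrightarrow> x \<in> cbox c d \<Longrightarrow>
      ((\<lambda>e. G e t x) has_real_derivative G' e t x) (at e)"
    and cG': "continuous_on ((UNIV \<times> {a..b}) \<times> cbox c d) (\<lambda>((e, t), x). G' e t x)"
    and W': "\<And>t. t \<in> {a..b} \<Longrightarrow> ((\<lambda>e. W e t) has_real_derivative \<zeta> t) (at 0)"
    and \<zeta>b: "\<zeta> b = 0"
    and lin: "\<And>t x. t \<in> {a..b} \<Longrightarrow> x \<in> cbox c d \<Longrightarrow> G' 0 t x = A t x + M t x * \<zeta> t"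
    and A: "continuous_on ({a..b} \<times> cbox c d) (\<lambda>(t, x). A t x)"
    and M: "continuous_on ({a..b} \<times> cbox c d) (\<lambda>(t, x). M t x)"
  shows "integral {a..b} (\<lambda>t. exp (- integral {a..t} (\<lambda>\<tau>. integral (cbox c d) (M \<tau>))) *
           integral (cbox c d) (A t)) = 0"
proof -
  define g where "g = (\<lambda>e t. integral (cbox c d) (G e t))"
  define g' where "g' = (\<lambda>e t. integral (cbox c d) (G' e t))"
  define A1 where "A1 = (\<lambda>t. integral (cbox c d) (A t))"
  define M1 where "M1 = (\<lambda>t. integral (cbox c d) (M t))"
  define l where "l = (\<lambda>t. exp (- integral {a..t} M1))"
  have cg: "continuous_on (UNIV \<times> {a..b}) (\<lambda>(e, t). g e t)"
    using integral_continuous_on_param[of "UNIV \<times> {a..b}" c d "\<lambda>(e, t). G e t"] G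
    by (simp add: g_def case_prod_unfold)
  have cg': "continuous_on (UNIV \<times> {a..b}) (\<lambda>(e, t). g' e t)"
    using integral_continuous_on_param[of "UNIV \<times> {a..b}" c d "\<lambda>(e, t). G' e t"] cG'
    by (simp add: g'_def case_prod_unfold)
  have cA1: "continuous_on {a..b} A1" and cM1: "continuous_on {a..b} M1"
    unfolding A1_def M1_def
    using integral_continuous_on_param[OF A] integral_continuous_on_param[OF M] by auto
  have pair: "continuous_on S (Pair e)" for S :: "'a set" and e :: real
    by (intro continuous_intros)
  have sl: "continuous_on S (\<lambda>t. f e t)"
    if "continuous_on (UNIV \<times> {a..b}) (\<lambda>(e, t). f e t)" "S \<subseteq> {a..b}" for f :: "real \<Rightarrow> real \<Rightarrow> real" and e S
  proof -
    have "continuous_on S (\<lambda>t. (e, t))" by (intro continuous_intros)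
    from continuous_on_compose2[OF that(1) this] that(2) show ?thesis by auto
  qed
  have slG: "continuous_on (UNIV \<times> cbox c d) (\<lambda>(e, x). f e t x)"
    if "continuous_on ((UNIV \<times> {a..b}) \<times> cbox c d) (\<lambda>((e, t), x). f e t x)" "t \<in> {a..b}"
    for f :: "real \<Rightarrow> real \<Rightarrow> 'a \<Rightarrow> real" and t
    using continuous_on_compose2[OF that(1), of "UNIV \<times> cbox c d" "\<lambda>y. ((fst y, t), snd y)"] that(2)
    by (force intro!: continuous_intros simp: case_prod_unfold)
  have dg: "((\<lambda>e. g e t) has_real_derivative g' e t) (at e)" if t: "t \<in> {a..b}" for e t
    unfolding g_def g'_def
  proof (rule leibniz_rule_field_derivative[where U=UNIV])
    show "G e t integrable_on cbox c d" for e
      using continuous_on_compose2[OF slG[OF G t] pair[of "cbox c d" e]]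
      by (auto intro!: integrable_continuous)
  qed (use G'[OF t] slG[OF cG' t] in auto)
  \<comment> \<open>In integrated form only the right-hand side is differentiated in
    \<open>e\<close>; the differential equation itself would call for a mixed derivative of
    \<open>W\<close>.\<close>
  have W_int: "W e t = za + integral {a..t} (g e)" if t: "t \<in> {a..b}" for e t
  proof -
    have "(g e has_integral W e t - W e a) {a..t}"
    proof (rule fundamental_theorem_of_calculus)
      show "(W e has_vector_derivative g e x) (at x within {a..t})" if "x \<in> {a..t}" for x
        using ode[of x e] that t unfolding g_def has_real_derivative_iff_has_vector_derivative
        by (auto intro: has_vector_derivative_within_subset)
    qed (use t in auto)
    then show ?thesis by (simp add: init integral_unique)
  qed
  have \<zeta>: "\<zeta> t = integral {a..t} (g' 0)" if t: "t \<in> {a..b}" for t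
  proof -
    have "((\<lambda>e. integral (cbox a t) (g e)) has_real_derivative integral (cbox a t) (g' 0)) (at 0)"
    proof (rule leibniz_rule_field_derivative[where U=UNIV])
      show "((\<lambda>e. g e s) has_real_derivative g' e s) (at e)" if "s \<in> cbox a t" for e s
        using dg[of s e] that t by auto
      show "g e integrable_on cbox a t" for e
        using sl[OF cg, of "{a..t}" e] t by (auto intro!: integrable_continuous_real)
      show "continuous_on (UNIV \<times> cbox a t) (\<lambda>(x, t). g' x t)"
        using t by (intro continuous_on_subset[OF cg']) auto
    qed auto
    then have "((\<lambda>e. W e t) has_real_derivative integral {a..t} (g' 0)) (at 0)"
      unfolding W_int[OF t] by (auto intro!: derivative_eq_intros)
    with W'[OF t] show ?thesis by (rule DERIV_unique)
  qed
  have g'0: "g' 0 t = A1 t + M1 t * \<zeta> t" if t: "t \<in> {a..b}" for t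
  proof -
    have sub: "Pair t ` cbox c d \<subseteq> {a..b} \<times> cbox c d" using t by auto
    have "A t integrable_on cbox c d" "M t integrable_on cbox c d"
      using continuous_on_compose2[OF A pair sub] continuous_on_compose2[OF M pair sub]
      by (auto intro: integrable_continuous)
    then have "integral (cbox c d) (\<lambda>x. A t x + M t x * \<zeta> t) = A1 t + M1 t * \<zeta> t"
      unfolding A1_def M1_def
      by (subst Henstock_Kurzweil_Integration.integral_add) (auto intro: integrable_on_mult_left)
    then show ?thesis
      unfolding g'_def using lin[OF t] by (metis (no_types, lifting) integral_cong)
  qed
  \<comment> \<open>\<open>W'\<close> speaks of each time separately; differentiability of \<zeta>
    in time comes from its integral representation and the continuity of
    \<open>g' 0\<close>.\<close>
  have d\<zeta>: "(\<zeta> has_real_derivative A1 t + M1 t * \<zeta> t) (at t within {a..b})" if t: "t \<in> {a..b}" for t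
  proof -
    have "((\<lambda>t. integral {a..t} (g' 0)) has_real_derivative g' 0 t) (at t within {a..b})"
      by (rule integral_has_real_derivative[OF sl[OF cg' order_refl] t])
    then have "(\<zeta> has_real_derivative g' 0 t) (at t within {a..b})"
      by (rule has_field_derivative_transform_within[OF _ zero_less_one t]) (simp add: \<zeta>)
    then show ?thesis using g'0[OF t] by simp
  qed
  have dl: "(l has_real_derivative - M1 t * l t) (at t within {a..b})" if t: "t \<in> {a..b}" for t
    unfolding l_def
    by (rule DERIV_cong[OF DERIV_chain2[OF DERIV_exp DERIV_minus[OF integral_has_real_derivative[OF cM1 t]]]]) simp
  have "((\<lambda>t. l t * A1 t) has_integral l b * \<zeta> b - l a * \<zeta> a) {a..b}"
  proof (rule fundamental_theorem_of_calculus)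
    show "((\<lambda>t. l t * \<zeta> t) has_vector_derivative l t * A1 t) (at t within {a..b})" if "t \<in> {a..b}" for t
      unfolding has_real_derivative_iff_has_vector_derivative[symmetric]
      by (rule DERIV_cong[OF DERIV_mult[OF dl[OF that] d\<zeta>[OF that]]]) (simp add: algebra_simps)
  qed (use ab in auto)
  moreover have "\<zeta> a = 0" using \<zeta>[of a] ab by simp
  ultimately have "integral {a..b} (\<lambda>t. l t * A1 t) = 0"
    using \<zeta>b by (simp add: integral_unique)
  then show ?thesis unfolding l_def A1_def M1_def .
qed

section \<open>Continuity of the weighted partial derivatives\<close>

lemma largs_shift:
  "largs a b aa bb \<alpha> \<beta> u y t x = largs a b aa bb \<alpha> \<beta> u 0 t x + (0, 0, 0, 0, y)"
  by (simp add: largs_def)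

lemma continuous_on_largs_shift:
  assumes "admissible a b aa bb \<alpha> \<beta> g u" and "continuous_on {a..b} z"
  shows "continuous_on (Pset a b aa bb) (\<lambda>p. largs a b aa bb \<alpha> \<beta> u (z (fst p)) (fst p) (snd p))"
proof -
  have "continuous_on (Pset a b aa bb) (\<lambda>p. z (fst p))"
    by (rule continuous_on_compose2[OF assms(2)]) (auto simp: Pset_def intro!: continuous_intros)
  then show ?thesis
    unfolding largs_shift[of _ _ _ _ _ _ _ "z _"]
    by (intro continuous_intros continuous_on_largs[OF assms(1)])
qed

lemma fst_dir [simp]: "fst (dir_u j) = 0" "fst (dir_Dt j) = 0" "fst (dir_Dx i j) = 0" "fst dir_z = 0"
  by (simp_all add: dir_u_def dir_Dt_def dir_Dx_def dir_z_def)

lemma continuous_on_pderivL: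
  fixes L :: "('n::finite, 'm::finite) larg \<Rightarrow> real"
  assumes L: "C1_on (S \<times> UNIV) L" and q: "continuous_on T q" "\<And>p. p \<in> T \<Longrightarrow> fst (q p) \<in> S"
    and v: "fst v = 0"
  shows "continuous_on T (\<lambda>p. pderivL L (q p) v)"
proof -
  obtain L' where L': "\<And>p. p \<in> S \<times> UNIV \<Longrightarrow> (L has_derivative blinfun_apply (L' p)) (at p within S \<times> UNIV)"
    and c: "continuous_on (S \<times> UNIV) L'"
    using L unfolding C1_on_def by blast
  have m: "q p \<in> S \<times> UNIV" if "p \<in> T" for p
    using q(2)[OF that] by (simp only: mem_Times_iff UNIV_I simp_thms)
  have "continuous_on T (\<lambda>p. L' (q p) v)"
    by (intro blinfun.continuous_on continuous_on_const continuous_on_compose2[OF c q(1)]) (use m in blast)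
  then show ?thesis
    by (rule continuous_on_eq) (use pderivL_eq[OF L'[OF m] q(2) v] in simp)
qed

lemma continuous_on_lamLv:
  fixes L :: "('n::finite, 'm::finite) larg \<Rightarrow> real"
  assumes L: "C1_on (Pset a b aa bb \<times> UNIV) L" and u: "admissible a b aa bb \<alpha> \<beta> g u"
    and z: "continuous_on {a..b} z" and v: "fst v = 0"
  shows "continuous_on (Pset a b aa bb) (lamLv L a b aa bb \<alpha> \<beta> u z v)"
proof -
  let ?P = "Pset a b aa bb"
  let ?q = "\<lambda>p. largs a b aa bb \<alpha> \<beta> u (z (fst p)) (fst p) (snd p)"
  have pd: "continuous_on ?P (\<lambda>p. pderivL L (?q p) v)" if "fst v = 0" for v
    by (rule continuous_on_pderivL[OF L continuous_on_largs_shift[OF u z] _ that])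
       (auto simp: largs_def)
  have "continuous_on ({a..b} \<times> cbox aa bb) (\<lambda>(t, x). pderivL L (?q (t, x)) dir_z)"
    using pd[of dir_z] by (simp add: Pset_def case_prod_unfold)
  from integral_continuous_on_param[OF this]
  have M: "continuous_on {a..b} (\<lambda>\<tau>. integral (cbox aa bb) (\<lambda>x. pderivL L (largs a b aa bb \<alpha> \<beta> u (z \<tau>) \<tau> x) dir_z))"
    by simp
  have "continuous_on {a..b} (lam L a b aa bb \<alpha> \<beta> u z)"
    unfolding lam_def[abs_def]
    by (intro continuous_intros indefinite_integral_continuous_1 integrable_continuous_real M)
  then have "continuous_on ?P (\<lambda>p. lam L a b aa bb \<alpha> \<beta> u z (fst p))"
    by (rule continuous_on_compose2) (auto simp: Pset_def intro!: continuous_intros)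
  then show ?thesis
    unfolding lamLv_def[abs_def] by (intro continuous_intros pd v)
qed

text \<open>The abstract linearization applied to \<open>L\<close> along the path of its arguments,
  with forcing term the derivative of \<open>L\<close> in the direction of \<eta> and its Caputo
  derivatives, and feedback coefficient its z-derivative.\<close>

lemma first_variation:
  fixes aa bb :: "real^'n" and \<alpha> :: "real^'m" and \<beta> :: "real^'m^'n"
    and g u \<eta> :: "real \<times> (real^'n) \<Rightarrow> real^'m" and L :: "('n,'m) larg \<Rightarrow> real"
  assumes ab: "a < b" and abi: "\<forall>i. aa $ i < bb $ i"
    and alpha: "\<forall>j. \<alpha> $ j < 1" and beta: "\<forall>i j. \<beta> $ i $ j < 1"
    and L': "\<And>p. p \<in> Pset a b aa bb \<times> UNIV \<Longrightarrow>
      (L has_derivative blinfun_apply (L' p)) (at p within Pset a b aa bb \<times> UNIV)"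
    and cL': "continuous_on (Pset a b aa bb \<times> UNIV) L'"
    and sol: "\<forall>v. admissible a b aa bb \<alpha> \<beta> g v \<longrightarrow>
        Z v a = za \<and>
        (\<forall>t\<in>{a..b}. (Z v has_real_derivative
            integral (cbox aa bb) (\<lambda>x. L (largs a b aa bb \<alpha> \<beta> v (Z v t) t x))) (at t within {a..b}))"
    and u: "admissible a b aa bb \<alpha> \<beta> g u"
    and \<eta>: "admissible a b aa bb \<alpha> \<beta> (\<lambda>_. 0) \<eta>"
    and diff: "C1_on (UNIV \<times> {a..b}) (\<lambda>(\<epsilon>, t). Z (\<lambda>p. u p + \<epsilon> *\<^sub>R \<eta> p) t)"
    and ext: "((\<lambda>\<epsilon>. Z (\<lambda>p. u p + \<epsilon> *\<^sub>R \<eta> p) b) has_real_derivative 0) (at 0)"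
  shows "integral {a..b} (\<lambda>t. lam L a b aa bb \<alpha> \<beta> u (Z u) t * integral (cbox aa bb) (\<lambda>x.
      L' (largs a b aa bb \<alpha> \<beta> u (Z u t) t x) (0, snd (largs a b aa bb \<alpha> \<beta> \<eta> 0 t x)))) = 0"
proof -
  let ?P = "Pset a b aa bb"
  define W where "W = (\<lambda>e t. Z (\<lambda>p. u p + e *\<^sub>R \<eta> p) t)"
  have W0: "W 0 = Z u" by (simp add: W_def)
  obtain W' where W': "\<And>p. p \<in> UNIV \<times> {a..b} \<Longrightarrow>
      ((\<lambda>(e, t). W e t) has_derivative blinfun_apply (W' p)) (at p within UNIV \<times> {a..b})"
    and cW': "continuous_on (UNIV \<times> {a..b}) W'"
    using diff unfolding C1_on_def W_def by blast
  have cW: "continuous_on (UNIV \<times> {a..b}) (\<lambda>y. W (fst y) (snd y))"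
    using C1_on_imp_continuous_on[OF diff] by (simp add: W_def case_prod_unfold)
  \<comment> \<open>Joint C^1 dependence makes this partial derivative jointly continuous, as
    differentiation under the integral requires.\<close>
  define W1 where "W1 = (\<lambda>e t. W' (e, t) (1, 0))"
  have dW: "((\<lambda>e. W e t) has_real_derivative W1 e t) (at e)" if t: "t \<in> {a..b}" for e t
  proof -
    have "((\<lambda>e. case (e, t) of (e, t) \<Rightarrow> W e t) has_derivative (\<lambda>h. W' (e, t) (h, 0))) (at e within UNIV)"
    proof (rule has_derivative_in_compose[where f="\<lambda>e. (e, t)"])
      show "((\<lambda>e. (e, t)) has_derivative (\<lambda>h. (h, 0))) (at e within UNIV)"
        by (auto intro!: derivative_eq_intros)
      show "((\<lambda>(e, t). W e t) has_derivative blinfun_apply (W' (e, t))) (at (e, t) within range (\<lambda>e. (e, t)))"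
        by (rule has_derivative_subset[OF W']) (use t in auto)
    qed
    moreover have "W' (e, t) (h, 0) = W1 e t * h" for h
      using blinfun.scaleR_right[of "W' (e, t)" h "(1, 0)"] by (simp add: W1_def)
    ultimately show ?thesis by (simp add: has_field_derivative_def)
  qed
  define h :: "real \<Rightarrow> real^'n \<Rightarrow> ('n,'m) larg"
    where "h = (\<lambda>t x. (0, snd (largs a b aa bb \<alpha> \<beta> \<eta> 0 t x)))"
  define k :: "real \<Rightarrow> ('n,'m) larg" where "k = (\<lambda>y. (0, 0, 0, 0, y))"
  \<comment> \<open>The arguments of \<open>L\<close> along the variation, affine in
    \<open>e\<close> except for the last slot, which carries the perturbed solution.\<close>
  define Q where "Q = (\<lambda>e t x. largs a b aa bb \<alpha> \<beta> u 0 t x + e *\<^sub>R h t x + k (W e t))"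
  have Q: "largs a b aa bb \<alpha> \<beta> (\<lambda>p. u p + e *\<^sub>R \<eta> p) (W e t) t x = Q e t x"
    if "t \<in> {a..b}" "x \<in> cbox aa bb" for e t x
    unfolding Q_def h_def k_def by (rule largs_add_scaleR[OF ab abi alpha beta u \<eta> that])
  have Q0: "Q 0 t x = largs a b aa bb \<alpha> \<beta> u (Z u t) t x" for t x
    by (simp add: Q_def W0 k_def largs_shift[of _ _ _ _ _ _ _ "Z u t"])
  have fstQ: "fst (Q e t x) = (t, x)" for e t x
    by (simp add: Q_def h_def k_def largs_def)
  have QP: "Q e t x \<in> ?P \<times> UNIV" if "t \<in> {a..b}" "x \<in> cbox aa bb" for e t x
    using that by (simp only: mem_Times_iff fstQ mem_Pset UNIV_I simp_thms)
  let ?U = "((UNIV :: real set) \<times> {a..b}) \<times> cbox aa bb"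
  have cpair: "continuous_on ?U (\<lambda>y. (snd (fst y), snd y))" "(\<lambda>y. (snd (fst y), snd y)) ` ?U \<subseteq> ?P"
    by (auto intro!: continuous_intros simp: mem_Pset)
  have ch: "continuous_on ?U (\<lambda>y. h (snd (fst y)) (snd y))"
    using continuous_on_compose2[OF continuous_on_largs[OF \<eta>] cpair]
    unfolding h_def by (intro continuous_intros) simp
  have cu: "continuous_on ?U (\<lambda>y. largs a b aa bb \<alpha> \<beta> u 0 (snd (fst y)) (snd y))"
    using continuous_on_compose2[OF continuous_on_largs[OF u] cpair] by simp
  have cWU: "continuous_on ?U (\<lambda>y. W (fst (fst y)) (snd (fst y)))"
    using continuous_on_compose2[OF cW continuous_on_fst[OF continuous_on_id], of ?U] by auto
  have cQ: "continuous_on ?U (\<lambda>y. Q (fst (fst y)) (snd (fst y)) (snd y))"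
    unfolding Q_def k_def by (intro continuous_intros cu ch cWU)
  have QU: "(\<lambda>y. Q (fst (fst y)) (snd (fst y)) (snd y)) ` ?U \<subseteq> ?P \<times> UNIV"
    by (rule image_subsetI, rule QP) auto
  have cW1: "continuous_on ?U (\<lambda>y. W1 (fst (fst y)) (snd (fst y)))"
    unfolding W1_def
    using continuous_on_compose2[OF cW' continuous_on_fst[OF continuous_on_id], of ?U]
    by (intro blinfun.continuous_on continuous_on_const) auto
  have CL: "continuous_on (?P \<times> UNIV) L"
    unfolding continuous_on_eq_continuous_within using L' has_derivative_continuous by blast
  define G where "G = (\<lambda>e t x. L (Q e t x))"
  define G' where "G' = (\<lambda>e t x. L' (Q e t x) (h t x + k (W1 e t)))"
  have "integral {a..b} (\<lambda>t. exp (- integral {a..t} (\<lambda>\<tau>. integral (cbox aa bb) (\<lambda>x. L' (Q 0 \<tau> x) dir_z))) *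
           integral (cbox aa bb) (\<lambda>x. L' (Q 0 t x) (h t x))) = 0"
  proof (rule linearized_ode_integral_zero[where W=W and G=G and G'=G' and \<zeta>="W1 0" and za=za])
    have adm: "admissible a b aa bb \<alpha> \<beta> g (\<lambda>p. u p + e *\<^sub>R \<eta> p)" for e
      by (rule admissible_add_scaleR[OF ab abi alpha beta u \<eta>])
    show "W e a = za" for e using sol adm by (simp add: W_def)
    show "(W e has_real_derivative integral (cbox aa bb) (G e t)) (at t within {a..b})"
      if t: "t \<in> {a..b}" for e t
    proof -
      have "integral (cbox aa bb) (G e t) = integral (cbox aa bb)
          (\<lambda>x. L (largs a b aa bb \<alpha> \<beta> (\<lambda>p. u p + e *\<^sub>R \<eta> p) (W e t) t x))"
        unfolding G_def by (rule integral_cong) (simp add: Q[OF t])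
      then show ?thesis using sol adm[of e] t by (simp add: W_def)
    qed
    show "continuous_on ?U (\<lambda>((e, t), x). G e t x)"
      unfolding G_def case_prod_unfold by (rule continuous_on_compose2[OF CL cQ QU])
    show "((\<lambda>e. G e t x) has_real_derivative G' e t x) (at e)"
      if tx: "t \<in> {a..b}" "x \<in> cbox aa bb" for e t x
    proof -
      have "((\<lambda>e. Q e t x) has_derivative (\<lambda>d. d *\<^sub>R (h t x + k (W1 e t)))) (at e within UNIV)"
      proof -
        have "((\<lambda>e. k (W e t)) has_derivative (\<lambda>d. k (W1 e t * d))) (at e)"
          unfolding k_def
          by (intro has_derivative_Pair has_derivative_const)
             (use dW[OF tx(1)] in \<open>simp add: has_field_derivative_def\<close>)
        moreover have "((\<lambda>e. largs a b aa bb \<alpha> \<beta> u 0 t x + e *\<^sub>R h t x) has_derivative (\<lambda>d. d *\<^sub>R h t x)) (at e)"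
          by (auto intro!: derivative_eq_intros)
        ultimately have "((\<lambda>e. Q e t x) has_derivative (\<lambda>d. d *\<^sub>R h t x + k (W1 e t * d))) (at e)"
          unfolding Q_def by (rule has_derivative_add[rotated])
        then show ?thesis
          by (rule has_derivative_eq_rhs) (simp add: fun_eq_iff scaleR_add_right k_def mult.commute)
      qed
      \<comment> \<open>The path stays in the set within which \<open>L\<close> is differentiable,
        so the chain rule relative to its range yields a two-sided derivative in
        \<open>e\<close>.\<close>
      moreover have "(L has_derivative blinfun_apply (L' (Q e t x))) (at (Q e t x) within range (\<lambda>e. Q e t x))"
        by (rule has_derivative_subset[OF L'[OF QP[OF tx]]]) (use QP[OF tx] in blast)
      ultimately have "((\<lambda>e. L (Q e t x)) has_derivative (\<lambda>d. L' (Q e t x) (d *\<^sub>R (h t x + k (W1 e t))))) (at e within UNIV)"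
        by (rule has_derivative_in_compose)
      then show ?thesis
        unfolding has_field_derivative_def G_def G'_def
        by (rule has_derivative_eq_rhs) (simp add: fun_eq_iff blinfun.scaleR_right)
    qed
    show "continuous_on ?U (\<lambda>((e, t), x). G' e t x)"
      unfolding G'_def case_prod_unfold k_def
      by (intro blinfun.continuous_on continuous_intros continuous_on_compose2[OF cL' cQ QU] ch cW1)
    show "((\<lambda>e. W e t) has_real_derivative W1 0 t) (at 0)" if "t \<in> {a..b}" for t
      by (rule dW[OF that])
    show "W1 0 b = 0"
    proof -
      have "((\<lambda>e. W e b) has_real_derivative 0) (at 0)" using ext by (simp add: W_def)
      with dW[of b 0] ab show ?thesis by (auto intro: DERIV_unique)
    qed
    show "G' 0 t x = L' (Q 0 t x) (h t x) + L' (Q 0 t x) dir_z * W1 0 t" for t x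
    proof -
      have "k (W1 0 t) = W1 0 t *\<^sub>R dir_z" by (simp add: k_def dir_z_def)
      then show ?thesis by (simp add: G'_def blinfun.add_right blinfun.scaleR_right mult.commute)
    qed
    have c0: "continuous_on ({a..b} \<times> cbox aa bb) (\<lambda>y. ((0::real, fst y), snd y))"
      "(\<lambda>y. ((0::real, fst y), snd y)) ` ({a..b} \<times> cbox aa bb) \<subseteq> ?U"
      by (auto intro!: continuous_intros)
    have "continuous_on ?U (\<lambda>y. L' (Q (fst (fst y)) (snd (fst y)) (snd y)) (h (snd (fst y)) (snd y)))"
      "continuous_on ?U (\<lambda>y. L' (Q (fst (fst y)) (snd (fst y)) (snd y)) dir_z)"
      by (intro blinfun.continuous_on continuous_on_const continuous_on_compose2[OF cL' cQ QU] ch)+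
    from this[THEN continuous_on_compose2, OF c0]
    show "continuous_on ({a..b} \<times> cbox aa bb) (\<lambda>(t, x). L' (Q 0 t x) (h t x))"
      "continuous_on ({a..b} \<times> cbox aa bb) (\<lambda>(t, x). L' (Q 0 t x) dir_z)"
      by (simp_all add: case_prod_unfold)
  qed (rule ab)
  \<comment> \<open>\<open>lam\<close> is defined through \<open>pderivL\<close>; the exponents
    agree because \<open>dir_z\<close> leaves the point \<open>(t, x)\<close> fixed.\<close>
  moreover have "integral {a..t} (\<lambda>\<tau>. integral (cbox aa bb) (\<lambda>x. L' (Q 0 \<tau> x) dir_z)) =
      integral {a..t} (\<lambda>\<tau>. integral (cbox aa bb) (\<lambda>x. pderivL L (Q 0 \<tau> x) dir_z))"
    if "t \<in> {a..b}" for t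
    using that
    by (intro integral_cong pderivL_eq[OF L'[OF QP], symmetric]) (auto simp: fstQ mem_Pset)
  then have "integral {a..b} (\<lambda>t. exp (- integral {a..t} (\<lambda>\<tau>. integral (cbox aa bb) (\<lambda>x. L' (Q 0 \<tau> x) dir_z))) *
           integral (cbox aa bb) (\<lambda>x. L' (Q 0 t x) (h t x))) =
     integral {a..b} (\<lambda>t. lam L a b aa bb \<alpha> \<beta> u (Z u) t * integral (cbox aa bb) (\<lambda>x. L' (Q 0 t x) (h t x)))"
    by (intro integral_cong) (simp add: lam_def Q0)
  ultimately show ?thesis by (simp add: Q0 h_def)
qed

theorem theorem3p5:
  fixes a b za :: real
    and aa bb :: "real^'n"
    and \<alpha> :: "real^'m" and \<beta> :: "real^'m^'n"
    and g u :: "real \<times> (real^'n) \<Rightarrow> real^'m"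
    and L :: "('n,'m) larg \<Rightarrow> real"
    and Z :: "(real \<times> (real^'n) \<Rightarrow> real^'m) \<Rightarrow> real \<Rightarrow> real"
  assumes ab: "a < b"
    and abi: "\<forall>i. aa $ i < bb $ i"
    and alpha: "\<forall>j. 0 < \<alpha> $ j \<and> \<alpha> $ j < 1"
    and beta: "\<forall>i j. 0 < \<beta> $ i $ j \<and> \<beta> $ i $ j < 1"
    and L_C1: "C1_on (Pset a b aa bb \<times> UNIV) L"
    and Z_sol: "\<forall>v. admissible a b aa bb \<alpha> \<beta> g v \<longrightarrow>
        Z v a = za \<and>
        (\<forall>t\<in>{a..b}. (Z v has_real_derivative
            integral (cbox aa bb) (\<lambda>x. L (largs a b aa bb \<alpha> \<beta> v (Z v t) t x))) (at t within {a..b}))"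
    and u_adm: "admissible a b aa bb \<alpha> \<beta> g u"
    and RLt_ex: "\<forall>j. (\<forall>p\<in>Pset a b aa bb. RL_t_exists a b (\<alpha> $ j) (lamLv L a b aa bb \<alpha> \<beta> u (Z u) (dir_Dt j)) p)
        \<and> continuous_on (Pset a b aa bb) (RL_t a b (\<alpha> $ j) (lamLv L a b aa bb \<alpha> \<beta> u (Z u) (dir_Dt j)))"
    and RLx_ex: "\<forall>i j. (\<forall>p\<in>Pset a b aa bb. RL_x_exists aa bb i (\<beta> $ i $ j) (lamLv L a b aa bb \<alpha> \<beta> u (Z u) (dir_Dx i j)) p)
        \<and> continuous_on (Pset a b aa bb) (RL_x aa bb i (\<beta> $ i $ j) (lamLv L a b aa bb \<alpha> \<beta> u (Z u) (dir_Dx i j)))"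
    and Z_diff: "\<forall>\<eta>. admissible a b aa bb \<alpha> \<beta> (\<lambda>_. 0) \<eta> \<longrightarrow>
        C1_on (UNIV \<times> {a..b}) (\<lambda>(\<epsilon>, t). Z (\<lambda>p. u p + \<epsilon> *\<^sub>R \<eta> p) t)"
    and extremal: "\<forall>\<eta>. admissible a b aa bb \<alpha> \<beta> (\<lambda>_. 0) \<eta> \<longrightarrow>
        ((\<lambda>\<epsilon>. Z (\<lambda>p. u p + \<epsilon> *\<^sub>R \<eta> p) b) has_real_derivative 0) (at 0)"
  shows "\<forall>j. \<forall>p\<in>Pset a b aa bb.
      lamLv L a b aa bb \<alpha> \<beta> u (Z u) (dir_u j) p
      + RL_t a b (\<alpha> $ j) (lamLv L a b aa bb \<alpha> \<beta> u (Z u) (dir_Dt j)) p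
      + (\<Sum>i\<in>UNIV. RL_x aa bb i (\<beta> $ i $ j) (lamLv L a b aa bb \<alpha> \<beta> u (Z u) (dir_Dx i j)) p) = 0"
proof (intro allI ballI)
  fix j p0 assume p0: "p0 \<in> Pset a b aa bb"
  let ?P = "Pset a b aa bb"
  let ?F = "lamLv L a b aa bb \<alpha> \<beta> u (Z u)"
  let ?RLt = "RL_t a b (\<alpha> $ j) (?F (dir_Dt j))"
  let ?RLx = "\<lambda>i. RL_x aa bb i (\<beta> $ i $ j) (?F (dir_Dx i j))"
  let ?E = "\<lambda>p. ?F (dir_u j) p + ?RLt p + (\<Sum>i\<in>UNIV. ?RLx i p)"
  have alpha1: "\<forall>j. \<alpha> $ j < 1" and beta1: "\<forall>i j. \<beta> $ i $ j < 1" using alpha beta by auto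
  obtain L' where L': "\<And>p. p \<in> ?P \<times> UNIV \<Longrightarrow>
      (L has_derivative blinfun_apply (L' p)) (at p within ?P \<times> UNIV)"
    and cL': "continuous_on (?P \<times> UNIV) L'"
    using L_C1 unfolding C1_on_def by blast
  have z: "continuous_on {a..b} (Z u)"
    using Z_sol u_adm DERIV_continuous unfolding continuous_on_eq_continuous_within by blast
  have cF: "continuous_on ?P (?F v)" if "fst v = 0" for v
    by (rule continuous_on_lamLv[OF L_C1 u_adm z that])
  have cRLt: "continuous_on ?P ?RLt" and cRLx: "\<And>i. continuous_on ?P (?RLx i)"
    using RLt_ex RLx_ex by auto
  show "?E p0 = 0"
  proof (rule fundamental_lemma_box_bump[OF ab abi _ _ p0])
    show "continuous_on ?P ?E"
      by (intro continuous_intros cF cRLt cRLx) simp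
  next
    fix p q :: "real \<times> (real^'n)"
    assume p: "a \<le> fst p" and pq: "fst p < fst q" and q: "fst q \<le> b"
      and pqk: "\<And>k. aa $ k \<le> snd p $ k \<and> snd p $ k < snd q $ k \<and> snd q $ k \<le> bb $ k"
    let ?B = "box_bump p q"
    let ?Bt = "caputo_t a b (\<alpha> $ j) ?B"
    let ?Bx = "\<lambda>i. caputo_x aa bb i (\<beta> $ i $ j) ?B"
    have B: "C1_on ?P ?B" by (rule C1_on_box_bump)
    have Bt: "C1_on ?P ?Bt"
      using alpha1 ab p pq by (intro C1_on_caputo_t_box_bump) auto
    have Bx: "C1_on ?P (?Bx i)" for i
      using beta1 abi pqk by (intro C1_on_caputo_x_box_bump) auto
    note cB = B[THEN C1_on_imp_continuous_on] and cBt = Bt[THEN C1_on_imp_continuous_on]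
      and cBx = Bx[THEN C1_on_imp_continuous_on]
    have B0: "\<forall>y\<in>frontier ?P. ?B y = 0"
    proof
      fix y assume "y \<in> frontier ?P"
      then have "\<not> (fst y \<in> {a<..<b} \<and> snd y \<in> box aa bb)"
        by (cases y) (auto simp: frontier_Pset)
      then have "\<not> (fst y \<in> {fst p<..<fst q} \<and> snd y \<in> box (snd p) (snd q))"
        using p q pqk by (meson greaterThanLessThan_iff le_less_trans less_le_trans mem_box_cart(1))
      then show "?B y = 0"
        by (rule box_bump_eq_0[rotated 2]) (use pq pqk in auto)
    qed
    \<comment> \<open>Perturbing only the \<open>j\<close>-th component leaves just the partial
      derivatives that belong to \<open>j\<close>, which isolates the \<open>j\<close>-th
      equation.\<close>
    define \<eta> where "\<eta> = (\<lambda>y. axis j (?B y))"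
    have adm: "admissible a b aa bb \<alpha> \<beta> (\<lambda>_. 0) \<eta>"
      unfolding \<eta>_def by (rule admissible_axis[OF ab abi B Bt Bx B0])
    let ?T = "\<lambda>y. ?F (dir_u j) y * ?B y + ?F (dir_Dt j) y * ?Bt y + (\<Sum>i\<in>UNIV. ?F (dir_Dx i j) y * ?Bx i y)"
    have cT: "continuous_on ?P ?T"
      by (intro continuous_intros cF cB cBt cBx) simp_all
    \<comment> \<open>\<lambda> depends on time alone and passes under the space integral;
      \<open>largs_axis\<close> then turns the total derivative of \<open>L\<close> into partial
      ones.\<close>
    have "lam L a b aa bb \<alpha> \<beta> u (Z u) t * integral (cbox aa bb) (\<lambda>x.
        L' (largs a b aa bb \<alpha> \<beta> u (Z u t) t x) (0, snd (largs a b aa bb \<alpha> \<beta> \<eta> 0 t x))) =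
      integral (cbox aa bb) (\<lambda>x. ?T (t, x))" if t: "t \<in> {a..b}" for t
      unfolding integral_mult_right[symmetric]
    proof (rule integral_cong)
      fix x assume x: "x \<in> cbox aa bb"
      let ?q = "largs a b aa bb \<alpha> \<beta> u (Z u t) t x"
      have P: "(t, x) \<in> ?P" using t x by (simp add: mem_Pset)
      have fq: "fst ?q \<in> ?P" using P by (simp add: largs_def)
      then have qP: "?q \<in> ?P \<times> UNIV" by (simp only: mem_Times_iff UNIV_I simp_thms)
      have "L' ?q v = pderivL L ?q v" if "fst v = 0" for v
        using pderivL_eq[OF L'[OF qP] fq that] by simp
      then show "lam L a b aa bb \<alpha> \<beta> u (Z u) t * L' ?q (0, snd (largs a b aa bb \<alpha> \<beta> \<eta> 0 t x)) = ?T (t, x)"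
        unfolding \<eta>_def largs_axis[OF ab abi P]
        by (simp add: blinfun.add_right blinfun.scaleR_right blinfun.sum_right lamLv_def
            distrib_left sum_distrib_left mult_ac)
    qed
    then have "integral ?P ?T = integral {a..b} (\<lambda>t. lam L a b aa bb \<alpha> \<beta> u (Z u) t * integral (cbox aa bb) (\<lambda>x.
        L' (largs a b aa bb \<alpha> \<beta> u (Z u t) t x) (0, snd (largs a b aa bb \<alpha> \<beta> \<eta> 0 t x))))"
      unfolding integral_Pset(1)[OF cT] by (intro integral_cong) simp
    also have "\<dots> = 0"
      by (rule first_variation[OF ab abi alpha1 beta1 L' cL' Z_sol u_adm adm])
         (use Z_diff extremal adm in auto)
    finally have T0: "integral ?P ?T = 0" .
    have int: "f integrable_on ?P" if "continuous_on ?P f" for f :: "_ \<Rightarrow> real"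
      using that unfolding Pset_eq_cbox by (rule integrable_continuous)
    have split: "integral ?P (\<lambda>y. f1 y + f2 y + (\<Sum>i\<in>UNIV. f3 i y)) =
        integral ?P f1 + integral ?P f2 + (\<Sum>i\<in>UNIV. integral ?P (f3 i))"
      if "continuous_on ?P f1" "continuous_on ?P f2" "\<And>i. continuous_on ?P (f3 i)"
      for f1 f2 :: "real \<times> (real^'n) \<Rightarrow> real" and f3 :: "'n \<Rightarrow> real \<times> (real^'n) \<Rightarrow> real"
    proof -
      have "integral ?P (\<lambda>y. f1 y + f2 y + (\<Sum>i\<in>UNIV. f3 i y)) =
          integral ?P (\<lambda>y. f1 y + f2 y) + integral ?P (\<lambda>y. \<Sum>i\<in>UNIV. f3 i y)"
        by (intro Henstock_Kurzweil_Integration.integral_add int continuous_intros that)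
      also have "integral ?P (\<lambda>y. f1 y + f2 y) = integral ?P f1 + integral ?P f2"
        by (intro Henstock_Kurzweil_Integration.integral_add int that)
      also have "integral ?P (\<lambda>y. \<Sum>i\<in>UNIV. f3 i y) = (\<Sum>i\<in>UNIV. integral ?P (f3 i))"
        by (intro Henstock_Kurzweil_Integration.integral_sum int that) simp
      finally show ?thesis .
    qed
    \<comment> \<open>Integration by parts is read from right to left: each Riemann-Liouville term
      tested with the bump becomes a Caputo derivative of the bump, which ends at
      \<open>?T\<close>.\<close>
    have "integral ?P (\<lambda>y. ?E y * ?B y) =
        integral ?P (\<lambda>y. ?F (dir_u j) y * ?B y + ?RLt y * ?B y + (\<Sum>i\<in>UNIV. ?RLx i y * ?B y))"
      by (simp add: distrib_right sum_distrib_right)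
    also have "\<dots> = integral ?P (\<lambda>y. ?F (dir_u j) y * ?B y) + integral ?P (\<lambda>y. ?RLt y * ?B y)
        + (\<Sum>i\<in>UNIV. integral ?P (\<lambda>y. ?RLx i y * ?B y))"
      by (intro split continuous_on_mult cF cB cRLt cRLx) simp
    also have "integral ?P (\<lambda>y. ?RLt y * ?B y) = integral ?P (\<lambda>y. ?F (dir_Dt j) y * ?Bt y)"
      by (rule integral_by_parts_caputo_t[OF alpha1[rule_format] ab cF _ cRLt B cBt B0, symmetric])
         (use RLt_ex in auto)
    also have "(\<Sum>i\<in>UNIV. integral ?P (\<lambda>y. ?RLx i y * ?B y)) =
        (\<Sum>i\<in>UNIV. integral ?P (\<lambda>y. ?F (dir_Dx i j) y * ?Bx i y))"
      by (rule sum.cong[OF refl],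
          rule integral_by_parts_caputo_x[OF beta1[rule_format] abi[rule_format] cF _ cRLx B cBx B0, symmetric])
         (use RLx_ex in auto)
    also have "integral ?P (\<lambda>y. ?F (dir_u j) y * ?B y) + integral ?P (\<lambda>y. ?F (dir_Dt j) y * ?Bt y)
        + (\<Sum>i\<in>UNIV. integral ?P (\<lambda>y. ?F (dir_Dx i j) y * ?Bx i y)) = integral ?P ?T"
      by (intro split[symmetric] continuous_on_mult cF cB cBt cBx) simp_all
    finally show "integral ?P (\<lambda>y. ?E y * ?B y) = 0" using T0 by simp
  qed
qed

end
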